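(* For $\mu,\alpha\in\mathbb{R}$ and $\varepsilon\ge 0$ consider the linear $2\pi$-periodic Hamiltonian system with Hamiltonian $$H(\xi,\eta,\tau)=\tfrac12\eta^2+\tfrac12\left[\varepsilon\cos\tau+\alpha+\tfrac{\mu}{4}\right]\xi^2 ,$$ i.e. $\xi'=\eta$, $\eta'=-\left(\varepsilon\cos\tau+\alpha+\frac{\mu}{4}\right)\xi$. For each $\mu\in\mathbb{R}$, the boundary between the stability and instability regions emanating from the resonance point $\alpha=\alpha_0=\frac{9-\mu}{4}$, $\varepsilon=0$ consists of the two curves $\alpha=\alpha_{-}(\mu,\varepsilon)$ and $\alpha=\alpha_{+}(\mu,\varepsilon)$ with, as $\varepsilon\to0^+$, $$\alpha_{\mp}(\mu,\varepsilon)=\frac{9-\mu}{4}+\frac1{16}\varepsilon^2\mp\frac1{32}\varepsilon^3+\frac{13}{5120}\varepsilon^4\pm\frac{5}{2048}\varepsilon^5+\mathcal{O}(\varepsilon^6)$$ (upper signs for $\alpha_-$, lower signs for $\alpha_+$). The instability region associated with this resonance is the region between the two curves.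
   Context: The system is the linearization at the equilibrium $P_1=(0,0)$ of the charged pendulum with Hamiltonian $\frac12 y^2-\alpha\cos x-\varepsilon\cos\tau\cos x-\frac{\mu}{2}\log(7+\cos2x)$. A linear periodic system is stable if all its solutions are bounded for all $\tau\in\mathbb{R}$, and unstable otherwise. The point $(\mu,\alpha_0,0)$ is the resonance $2\omega=N$ with $N=3$, where $\omega^2=\frac{\mu}{4}+\alpha_0$. "The boundary emanating from $(\alpha_0,0)$ consists of the two curves $\alpha_\pm$, with instability region between them" means: there are $\varepsilon_0>0$ and $\delta>0$ (for fixed $\mu$) such that $\alpha_\pm(\mu,\cdot)$ are defined on $[0,\varepsilon_0)$, equal $\alpha_0$ at $\varepsilon=0$, and for $0<\varepsilon<\varepsilon_0$, $|\alpha-\alpha_0|<\delta$, the system is unstable when $\alpha$ lies strictly between the two curves and stable when $\alpha$ is strictly outside the closed interval they bound. As $\mu$ varies these curves form surfaces in the parameter space $(\mu,\alpha,\varepsilon)$. *)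

theory Defs
  imports "HOL-Analysis.Analysis" "HOL-Library.Landau_Symbols"
begin

definition hamiltonian_solution ::
  "(real \<Rightarrow> real \<Rightarrow> real \<Rightarrow> real) \<Rightarrow> (real \<Rightarrow> real) \<Rightarrow> (real \<Rightarrow> real) \<Rightarrow> bool"
where
  "hamiltonian_solution H \<xi> \<eta> \<longleftrightarrow>
     (\<forall>\<tau>. (\<xi> has_real_derivative deriv (\<lambda>y. H (\<xi> \<tau>) y \<tau>) (\<eta> \<tau>)) (at \<tau>) \<and>
          (\<eta> has_real_derivative - deriv (\<lambda>x. H x (\<eta> \<tau>) \<tau>) (\<xi> \<tau>)) (at \<tau>))"

text \<open>Only used for linear systems, whose solutions all extend to the whole line.\<close>

definition hamiltonian_stable :: "(real \<Rightarrow> real \<Rightarrow> real \<Rightarrow> real) \<Rightarrow> bool" where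
  "hamiltonian_stable H \<longleftrightarrow>
     (\<forall>\<xi> \<eta>. hamiltonian_solution H \<xi> \<eta> \<longrightarrow> bounded (range (\<lambda>\<tau>. (\<xi> \<tau>, \<eta> \<tau>))))"

definition linH :: "real \<Rightarrow> real \<Rightarrow> real \<Rightarrow> real \<Rightarrow> real \<Rightarrow> real \<Rightarrow> real" where
  "linH \<mu> \<alpha> \<epsilon> \<xi> \<eta> \<tau> = 1/2 * \<eta>^2 + 1/2 * (\<epsilon> * cos \<tau> + \<alpha> + \<mu>/4) * \<xi>^2"

lemma hamiltonian_solution_linH_iff:
  "hamiltonian_solution (linH \<mu> \<alpha> \<epsilon>) \<xi> \<eta> \<longleftrightarrow>
     (\<forall>\<tau>. (\<xi> has_real_derivative \<eta> \<tau>) (at \<tau>) \<and>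
          (\<eta> has_real_derivative - (\<epsilon> * cos \<tau> + \<alpha> + \<mu>/4) * \<xi> \<tau>) (at \<tau>))"
proof -
  have "deriv (\<lambda>y. linH \<mu> \<alpha> \<epsilon> x y t) z = z" for x z t
    unfolding linH_def by (rule DERIV_imp_deriv) (auto intro!: derivative_eq_intros)
  moreover have "deriv (\<lambda>x. linH \<mu> \<alpha> \<epsilon> x y t) z = (\<epsilon> * cos t + \<alpha> + \<mu>/4) * z" for y z t
    unfolding linH_def by (rule DERIV_imp_deriv) (auto intro!: derivative_eq_intros)
  ultimately show ?thesis
    unfolding hamiltonian_solution_def by (simp only: mult_minus_left)
qed

text \<open>The two curves \<open>a\<close>, \<open>b\<close> in the \<open>(\<epsilon>, \<alpha>)\<close> half-plane are the whole boundary, near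
  \<open>(0, \<alpha>\<^sub>0)\<close>, of an instability region lying between them. On the curves themselves nothing is
  claimed. Segments rather than intervals are used so that the order of the curves is not part
  of the definition.\<close>

definition stability_boundary_from ::
  "(real \<Rightarrow> real \<Rightarrow> bool) \<Rightarrow> real \<Rightarrow> (real \<Rightarrow> real) \<Rightarrow> (real \<Rightarrow> real) \<Rightarrow> bool"
where
  "stability_boundary_from S \<alpha>\<^sub>0 a b \<longleftrightarrow>
     (\<exists>\<epsilon>\<^sub>0>0. \<exists>\<delta>>0.
        continuous_on {0..<\<epsilon>\<^sub>0} a \<and> continuous_on {0..<\<epsilon>\<^sub>0} b \<and>
        a 0 = \<alpha>\<^sub>0 \<and> b 0 = \<alpha>\<^sub>0 \<and>
        (\<forall>\<epsilon> \<alpha>. 0 < \<epsilon> \<and> \<epsilon> < \<epsilon>\<^sub>0 \<and> \<bar>\<alpha> - \<alpha>\<^sub>0\<bar> < \<delta> \<longrightarrow>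
           (\<alpha> \<in> open_segment (a \<epsilon>) (b \<epsilon>) \<longrightarrow> \<not> S \<alpha> \<epsilon>) \<and>
           (\<alpha> \<notin> closed_segment (a \<epsilon>) (b \<epsilon>) \<longrightarrow> S \<alpha> \<epsilon>)))"

end

theory Submission
  imports Defs
begin

text \<open>With \<open>\<beta> = \<alpha> + \<mu>/4\<close> the system is the Mathieu equation \<open>x'' = - (\<epsilon> cos t + \<beta>) x\<close>. Since its
  potential is even, the trace of the monodromy matrix is \<open>4 c(\<pi>) s'(\<pi>) - 2\<close> for the even and odd
  normalised solutions \<open>c\<close>, \<open>s\<close>. Reflection in \<open>\<pi>/2\<close> shows \<open>s'(\<pi>; \<epsilon>) = c(\<pi>; - \<epsilon>)\<close>, so near the
  resonance the system is unstable or stable according to whether \<open>c(\<pi>; \<epsilon>) c(\<pi>; - \<epsilon>)\<close> is negative or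
  positive. The Wronskian of two even solutions, both close to \<open>cos (3t/2)\<close>, shows that
  \<open>c(\<pi>; \<beta>, \<epsilon>)\<close> has the sign of \<open>\<beta> - b(\<epsilon>)\<close> for a Lipschitz curve \<open>b\<close>, and the two boundary
  curves are \<open>b(\<epsilon>)\<close> and \<open>b(- \<epsilon>)\<close>. The expansion of \<open>b\<close> follows from Green's identity applied to
  the exact solution at \<open>\<beta> = b(\<epsilon>)\<close> and a trigonometric polynomial that solves the equation up
  to \<open>O(\<epsilon>\<^sup>6)\<close> and satisfies the same boundary conditions at \<open>0\<close> and \<open>\<pi>\<close>.\<close>

subsection \<open>Hill equations\<close>

definition hill_solution :: "(real \<Rightarrow> real) \<Rightarrow> (real \<Rightarrow> real) \<Rightarrow> (real \<Rightarrow> real) \<Rightarrow> bool" where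
  "hill_solution q x y \<longleftrightarrow>
     (\<forall>t. (x has_real_derivative y t) (at t) \<and> (y has_real_derivative - q t * x t) (at t))"

lemma hill_solution_derivs:
  assumes "hill_solution q x y"
  shows "(x has_real_derivative y t) (at t within S)"
    and "(y has_real_derivative - q t * x t) (at t within S)"
  using assms unfolding hill_solution_def by (auto intro: has_field_derivative_at_within)

lemma hill_solution_continuous_on:
  assumes "hill_solution q x y"
  shows "continuous_on S x" and "continuous_on S y"
  by (rule DERIV_continuous_on, rule hill_solution_derivs[OF assms])+

lemma hill_solution_shift:
  assumes "hill_solution q x y"
  shows "hill_solution (\<lambda>t. q (t + d)) (\<lambda>t. x (t + d)) (\<lambda>t. y (t + d))"
  unfolding hill_solution_def
  using hill_solution_derivs[OF assms, of _ UNIV] by (auto intro: DERIV_shift[THEN iffD1])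

lemma hill_solution_reflect:
  assumes "hill_solution q x y"
  shows "hill_solution (\<lambda>t. q (d - t)) (\<lambda>t. x (d - t)) (\<lambda>t. - y (d - t))"
  unfolding hill_solution_def
proof (intro allI conjI)
  fix t
  note D = hill_solution_derivs(1)[OF assms, of _ UNIV] hill_solution_derivs(2)[OF assms, of _ UNIV]
  show "((\<lambda>t. x (d - t)) has_real_derivative - y (d - t)) (at t)"
    by (rule DERIV_cong[OF DERIV_chain2[OF D(1)]]) (auto intro!: derivative_eq_intros)
  show "((\<lambda>t. - y (d - t)) has_real_derivative - q (d - t) * x (d - t)) (at t)"
    by (rule DERIV_cong[OF DERIV_minus[OF DERIV_chain2[OF D(2)]]]) (auto intro!: derivative_eq_intros)
qed

lemma hill_solution_linear_combination:
  assumes "hill_solution q x y" "hill_solution q u v"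
  shows "hill_solution q (\<lambda>t. a * x t + b * u t) (\<lambda>t. a * y t + b * v t)"
  unfolding hill_solution_def
  by (auto intro!: derivative_eq_intros hill_solution_derivs[OF assms(1)]
      hill_solution_derivs[OF assms(2)] simp: algebra_simps)

lemma wronskian_constant:
  assumes "hill_solution q x y" "hill_solution q u v"
  shows "y t * u t - x t * v t = y s * u s - x s * v s"
proof (rule DERIV_isconst_all[where f = "\<lambda>t. y t * u t - x t * v t"], intro allI)
  fix t
  show "((\<lambda>t. y t * u t - x t * v t) has_real_derivative 0) (at t)"
    by (auto intro!: derivative_eq_intros hill_solution_derivs[OF assms(1)]
        hill_solution_derivs[OF assms(2)] simp: algebra_simps)
qed

text \<open>The coefficients are Wronskians of \<open>x\<close> with \<open>s\<close> and with
  \<open>c\<close>, hence independent of the base point; moving them to \<open>t\<close> reduces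
  both formulas to Cramer's rule. The base point \<open>a\<close> stays free so that data at
  \<open>- T\<close> can be used later.\<close>

lemma hill_solution_representation:
  assumes c: "hill_solution q c c'" and s: "hill_solution q s s'" and x: "hill_solution q x y"
    and W: "c a * s' a - c' a * s a = 1"
  shows "x t = (x a * s' a - y a * s a) * c t + (c a * y a - c' a * x a) * s t"
    and "y t = (x a * s' a - y a * s a) * c' t + (c a * y a - c' a * x a) * s' t"
proof -
  have 1: "c' t * s t - c t * s' t = -1" using wronskian_constant[OF c s, of t a] W by simp
  have 2: "x a * s' a - y a * s a = x t * s' t - y t * s t"
    using wronskian_constant[OF x s, of t a] by simp
  have 3: "c a * y a - c' a * x a = c t * y t - c' t * x t"
    using wronskian_constant[OF c x, of t a] by simp
  show "x t = (x a * s' a - y a * s a) * c t + (c a * y a - c' a * x a) * s t"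
    unfolding 2 3 using 1 by algebra
  show "y t = (x a * s' a - y a * s a) * c' t + (c a * y a - c' a * x a) * s' t"
    unfolding 2 3 using 1 by algebra
qed

text \<open>The integrand is the derivative of the Wronskian \<open>y * u - x * v\<close>. The term
  \<open>w + q * u\<close> is the defect of \<open>u\<close>, so \<open>u\<close> may be a solution
  for a different potential or an approximate solution.\<close>

lemma green_identity:
  assumes "hill_solution q x y" and u: "\<And>t. (u has_real_derivative v t) (at t)"
    and v: "\<And>t. (v has_real_derivative w t) (at t)" and "0 \<le> T"
  shows "((\<lambda>t. - x t * (w t + q t * u t)) has_integral
           (y T * u T - x T * v T) - (y 0 * u 0 - x 0 * v 0)) {0..T}"
proof (rule fundamental_theorem_of_calculus[OF \<open>0 \<le> T\<close>])
  fix t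
  show "((\<lambda>t. y t * u t - x t * v t) has_vector_derivative - x t * (w t + q t * u t))
      (at t within {0..T})"
    unfolding has_real_derivative_iff_has_vector_derivative[symmetric]
    by (auto intro!: derivative_eq_intros hill_solution_derivs[OF assms(1)]
        has_field_derivative_at_within[OF u] has_field_derivative_at_within[OF v]
        simp: algebra_simps)
qed

text \<open>Taylor coefficients at 0 of the solution of \<open>x'' = - q x\<close>, where
  \<open>Q\<close> holds those of \<open>q\<close>: the sum is the Cauchy product, and the
  denominator comes from differentiating twice.\<close>

fun hill_coeff :: "(nat \<Rightarrow> real) \<Rightarrow> real \<Rightarrow> real \<Rightarrow> nat \<Rightarrow> real" where
  "hill_coeff Q x0 y0 0 = x0"
| "hill_coeff Q x0 y0 (Suc 0) = y0"
| "hill_coeff Q x0 y0 (Suc (Suc n)) =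
     - (\<Sum>k\<le>n. Q k * hill_coeff Q x0 y0 (n - k)) / (real (Suc n) * real (Suc (Suc n)))"

text \<open>In the step to index \<open>m + 2\<close> the Cauchy product contributes at most
  \<open>(m + 1) * S * M\<close>, against a denominator \<open>(m + 1) * (m + 2)\<close>. The
  remaining factor \<open>R\<^sup>2 * S / (m + 2)\<close> is at most 1 once
  \<open>m \<ge> N\<close>, so finitely many initial terms determine the bound.\<close>

lemma hill_coeff_bounded:
  assumes "summable (\<lambda>n. Q n * R ^ n)" and "R > 0"
  shows "\<exists>M. \<forall>n. \<bar>hill_coeff Q x0 y0 n\<bar> * R ^ n \<le> M"
proof -
  define a where "a = hill_coeff Q x0 y0"
  from summable_imp_bounded[OF assms(1)] obtain S where "S > 0" and S: "\<And>n. norm (Q n * R ^ n) \<le> S"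
    unfolding bounded_pos by auto
  obtain N :: nat where N: "R\<^sup>2 * S \<le> real N" using real_arch_simple by blast
  define M where "M = (\<Sum>n\<le>Suc N. \<bar>a n\<bar> * R ^ n)"
  have "\<bar>a n\<bar> * R ^ n \<le> M" for n
  proof (induction n rule: less_induct)
    case (less n)
    show ?case
    proof (cases "n \<le> Suc N")
      case True
      then show ?thesis unfolding M_def
        using \<open>R > 0\<close> by (intro member_le_sum) auto
    next
      case False
      then obtain m where m: "n = Suc (Suc m)" "m \<ge> N" by (metis Suc_le_D not_less_eq_eq)
      have M0: "M \<ge> 0" unfolding M_def using \<open>R > 0\<close> by (intro sum_nonneg) auto
      have summand: "\<bar>Q k * a (m - k)\<bar> * R ^ m \<le> S * M" if "k \<le> m" for k
      proof -
        have "\<bar>Q k * a (m - k)\<bar> * R ^ m = norm (Q k * R ^ k) * (\<bar>a (m - k)\<bar> * R ^ (m - k))"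
          using that \<open>R > 0\<close> by (simp add: abs_mult power_add[symmetric] mult.assoc mult.left_commute)
        also have "\<dots> \<le> S * M"
          using S[of k] less.IH[of "m - k"] m that \<open>R > 0\<close> \<open>S > 0\<close> M0 by (intro mult_mono) auto
        finally show ?thesis .
      qed
      have "\<bar>\<Sum>k\<le>m. Q k * a (m - k)\<bar> * R ^ m \<le> (\<Sum>k\<le>m. \<bar>Q k * a (m - k)\<bar> * R ^ m)"
        using \<open>R > 0\<close> by (simp add: sum_distrib_right[symmetric] mult_right_mono)
      also have "\<dots> \<le> (\<Sum>k\<le>m. S * M)" using summand by (intro sum_mono) auto
      also have "\<dots> = real (Suc m) * (S * M)" by simp
      finally have "\<bar>\<Sum>k\<le>m. Q k * a (m - k)\<bar> * R ^ m * R\<^sup>2 \<le> real (Suc m) * (S * M) * R\<^sup>2"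
        by (intro mult_right_mono) auto
      also have "\<dots> = (R\<^sup>2 * S) * (real (Suc m) * M)" by (simp add: ac_simps)
      also have "\<dots> \<le> real (Suc (Suc m)) * (real (Suc m) * M)"
        using N m M0 by (intro mult_right_mono) auto
      finally have *: "\<bar>\<Sum>k\<le>m. Q k * a (m - k)\<bar> * R ^ m * R\<^sup>2
          \<le> (real (Suc m) * real (Suc (Suc m))) * M" by (simp add: ac_simps)
      have "\<bar>a n\<bar> * R ^ n = (\<bar>\<Sum>k\<le>m. Q k * a (m - k)\<bar> * R ^ m * R\<^sup>2)
          / (real (Suc m) * real (Suc (Suc m)))"
        unfolding m a_def by (simp add: abs_mult power2_eq_square ac_simps del: of_nat_Suc)
      also have "\<dots> \<le> M" using * by (subst pos_divide_le_eq) (auto simp: mult_ac simp del: of_nat_Suc)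
      finally show ?thesis .
    qed
  qed
  then show ?thesis unfolding a_def by blast
qed

text \<open>The coefficients are bounded against every radius, so their power series converges
  everywhere; termwise differentiation and the Cauchy product then give the equation.\<close>

lemma hill_solution_exists:
  assumes Q: "\<And>t. (\<lambda>n. Q n * t ^ n) sums q t"
  shows "\<exists>x y. hill_solution q x y \<and> x 0 = x0 \<and> y 0 = y0"
proof -
  define a where "a = hill_coeff Q x0 y0"
  have sa: "summable (\<lambda>n. norm (a n) * r ^ n)" if "r \<ge> 0" for r
  proof -
    \<comment> \<open>Abel's lemma asks for a bound at a radius strictly larger than
      \<open>r\<close>.\<close>
    have "\<exists>M. \<forall>n. \<bar>a n\<bar> * (r + 1) ^ n \<le> M"
      unfolding a_def using Q[THEN sums_summable] that by (intro hill_coeff_bounded) auto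
    then obtain M where "\<And>n. \<bar>a n\<bar> * (r + 1) ^ n \<le> M" by blast
    then show ?thesis using that by (intro Abel_lemma[of r "r + 1"]) auto
  qed
  have na: "summable (\<lambda>n. norm (a n * t ^ n))" for t
    using sa[of "\<bar>t\<bar>"] by (simp add: abs_mult power_abs)
  have nq: "summable (\<lambda>n. norm (Q n * t ^ n))" for t
    using Abel_lemma[of "\<bar>t\<bar>" "\<bar>t\<bar> + 1" Q] summable_imp_bounded[OF Q[THEN sums_summable], of "\<bar>t\<bar> + 1"]
    unfolding bounded_iff by (auto simp: abs_mult power_abs)
  have suma: "summable (\<lambda>n. a n * t ^ n)" for t
    by (rule summable_norm_cancel[OF na])
  have sumd: "summable (\<lambda>n. diffs a n * t ^ n)" for t
    using termdiff_converges_all[OF suma] .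
  define x where "x = (\<lambda>t. \<Sum>n. a n * t ^ n)"
  define y where "y = (\<lambda>t. \<Sum>n. diffs a n * t ^ n)"
  \<comment> \<open>Differentiating twice multiplies by exactly the denominators in
    \<open>hill_coeff\<close>.\<close>
  have dd: "diffs (diffs a) n = - (\<Sum>k\<le>n. Q k * a (n - k))" for n
    unfolding diffs_def a_def by (simp del: of_nat_Suc)
  have "(\<Sum>n. diffs (diffs a) n * t ^ n) = - q t * x t" for t
  proof -
    have "(\<lambda>n. \<Sum>k\<le>n. (Q k * t ^ k) * (a (n - k) * t ^ (n - k))) sums (q t * x t)"
      using Cauchy_product_sums[OF nq na, of t t] sums_unique[OF Q] unfolding x_def by simp
    also have "(\<lambda>n. \<Sum>k\<le>n. (Q k * t ^ k) * (a (n - k) * t ^ (n - k)))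
        = (\<lambda>n. - (diffs (diffs a) n * t ^ n))"
    proof
      fix n
      have "(\<Sum>k\<le>n. (Q k * t ^ k) * (a (n - k) * t ^ (n - k))) = (\<Sum>k\<le>n. Q k * a (n - k) * t ^ n)"
      proof (rule sum.cong)
        fix k assume "k \<in> {..n}"
        then have "t ^ n = t ^ k * t ^ (n - k)" by (simp add: power_add[symmetric])
        then show "(Q k * t ^ k) * (a (n - k) * t ^ (n - k)) = Q k * a (n - k) * t ^ n"
          by (simp only: mult_ac)
      qed simp
      then show "(\<Sum>k\<le>n. (Q k * t ^ k) * (a (n - k) * t ^ (n - k))) = - (diffs (diffs a) n * t ^ n)"
        unfolding dd by (simp add: sum_distrib_right)
    qed
    finally have "(\<lambda>n. - (- (diffs (diffs a) n * t ^ n))) sums - (q t * x t)" by (rule sums_minus)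
    then show ?thesis using sums_unique by force
  qed
  then have "hill_solution q x y"
    unfolding hill_solution_def x_def y_def
    using termdiffs_strong_converges_everywhere[OF suma] termdiffs_strong_converges_everywhere[OF sumd]
    by simp
  moreover have "x 0 = x0" "y 0 = y0"
    unfolding x_def y_def by (simp_all add: a_def diffs_def)
  ultimately show ?thesis by blast
qed

text \<open>A Gronwall estimate for the squared distance \<open>E\<close> in the phase plane. The
  splitting \<open>q1 x1 - q2 x2 = q1 (x1 - x2) + (q1 - q2) x2\<close> is why bounds on
  \<open>q1\<close> and on \<open>(q1 - q2) x2\<close> suffice.\<close>

lemma hill_solution_perturbation:
  assumes 1: "hill_solution q1 x1 y1" and 2: "hill_solution q2 x2 y2"
    and init: "x1 0 = x2 0" "y1 0 = y2 0"
    and K: "\<And>t. t \<in> {0..T} \<Longrightarrow> \<bar>q1 t\<bar> \<le> K"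
    and \<rho>: "\<And>t. t \<in> {0..T} \<Longrightarrow> \<bar>(q1 t - q2 t) * x2 t\<bar> \<le> \<rho>"
    and t: "t \<in> {0..T}"
  shows "(x1 t - x2 t)\<^sup>2 + (y1 t - y2 t)\<^sup>2 \<le> \<rho>\<^sup>2 * T * exp ((2 + K) * T)"
proof -
  define E where "E = (\<lambda>t. (x1 t - x2 t)\<^sup>2 + (y1 t - y2 t)\<^sup>2)"
  define E' where "E' = (\<lambda>t. 2 * (x1 t - x2 t) * (y1 t - y2 t)
    + 2 * (y1 t - y2 t) * (- q1 t * x1 t + q2 t * x2 t))"
  define k where "k = 2 + K"
  have K0: "K \<ge> 0" using K[OF t] by linarith
  have E: "(E has_real_derivative E' t) (at t within S)" for t S
    unfolding E_def E'_def
    by (auto intro!: derivative_eq_intros hill_solution_derivs[OF 1] hill_solution_derivs[OF 2]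
        simp: algebra_simps)
  have bd: "E' t \<le> k * E t + \<rho>\<^sup>2" if "t \<in> {0..T}" for t
  proof -
    define d e g where "d = x1 t - x2 t" "e = y1 t - y2 t" "g = (q1 t - q2 t) * x2 t"
    have E1: "E' t = 2 * d * e * (1 - q1 t) - 2 * e * g"
      unfolding E'_def d_e_g_def by (simp add: algebra_simps)
    have "2 * d * e * (1 - q1 t) \<le> \<bar>2 * d * e\<bar> * \<bar>1 - q1 t\<bar>" by (metis abs_ge_self abs_mult)
    also have "\<dots> \<le> (d\<^sup>2 + e\<^sup>2) * (1 + K)"
    proof (rule mult_mono)
      show "\<bar>2 * d * e\<bar> \<le> d\<^sup>2 + e\<^sup>2"
        using sum_squares_bound[of "\<bar>d\<bar>" "\<bar>e\<bar>"] by (simp add: abs_mult)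
      show "\<bar>1 - q1 t\<bar> \<le> 1 + K" using K[OF that] by linarith
    qed auto
    finally have "2 * d * e * (1 - q1 t) \<le> (d\<^sup>2 + e\<^sup>2) * (1 + K)" .
    moreover have "- 2 * e * g \<le> e\<^sup>2 + g\<^sup>2" using zero_le_power2[of "e + g"]
      by (simp add: power2_sum algebra_simps)
    moreover have "g\<^sup>2 \<le> \<rho>\<^sup>2" using \<rho>[OF that] unfolding d_e_g_def
      by (meson abs_ge_zero abs_le_square_iff abs_of_nonneg dual_order.trans order_refl
          power2_le_iff_abs_le)
    ultimately have "E' t \<le> (d\<^sup>2 + e\<^sup>2) * (1 + K) + (d\<^sup>2 + e\<^sup>2) + \<rho>\<^sup>2"
      unfolding E1 using zero_le_power2[of d] by linarith
    then show ?thesis unfolding E_def k_def d_e_g_def(1,2)[symmetric] by (simp add: algebra_simps)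
  qed
  \<comment> \<open>Integrating factor: as \<open>exp (- k * s) \<le> 1\<close>, the inequality
    \<open>E' \<le> k E + \<rho>\<^sup>2\<close> makes this function nonincreasing.\<close>
  have "E t * exp (- k * t) - \<rho>\<^sup>2 * t \<le> E 0 * exp (- k * 0) - \<rho>\<^sup>2 * 0"
  proof (rule DERIV_nonpos_imp_nonincreasing[where f = "\<lambda>t. E t * exp (- k * t) - \<rho>\<^sup>2 * t"])
    show "0 \<le> t" using t by simp
    fix s assume s: "0 \<le> s" "s \<le> t"
    have D: "((\<lambda>t. E t * exp (- k * t) - \<rho>\<^sup>2 * t) has_real_derivative
        (E' s - k * E s) * exp (- k * s) - \<rho>\<^sup>2) (at s)"
      by (auto intro!: derivative_eq_intros E simp: algebra_simps)
    have "exp (- k * s) \<le> 1" using s K0 unfolding k_def by (simp add: mult_nonpos_nonneg)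
    then have "\<rho>\<^sup>2 * exp (- k * s) \<le> \<rho>\<^sup>2 * 1" by (intro mult_left_mono) auto
    moreover have "(E' s - k * E s) * exp (- k * s) \<le> \<rho>\<^sup>2 * exp (- k * s)"
      using bd[of s] s t by (intro mult_right_mono) auto
    ultimately have "(E' s - k * E s) * exp (- k * s) - \<rho>\<^sup>2 \<le> 0" by linarith
    then show "\<exists>z. ((\<lambda>t. E t * exp (- k * t) - \<rho>\<^sup>2 * t) has_real_derivative z) (at s) \<and> z \<le> 0"
      using D by blast
  qed
  then have "E t * exp (- k * t) \<le> \<rho>\<^sup>2 * t" using init unfolding E_def by simp
  then have "E t \<le> \<rho>\<^sup>2 * t * exp (k * t)"
    by (simp add: exp_minus field_simps)
  also have "\<dots> \<le> \<rho>\<^sup>2 * T * exp (k * T)"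
    using t K0 unfolding k_def by (intro mult_mono) auto
  finally show ?thesis unfolding E_def k_def .
qed

subsection \<open>Stability of even periodic Hill equations\<close>

text \<open>Evenness of \<open>q\<close> makes \<open>c\<close> even and \<open>s\<close> odd, so
  the values at \<open>- T\<close> are known from those at \<open>T\<close>. Translation by the
  period \<open>2 * T\<close> carries \<open>- T\<close> to \<open>T\<close>, which expresses the
  whole monodromy matrix through half a period.\<close>

lemma hill_monodromy:
  assumes even: "\<And>t. q (- t) = q t" and per: "\<And>t. q (t + 2 * T) = q t"
    and c: "hill_solution q c c'" and s: "hill_solution q s s'"
    and init: "c 0 = 1" "c' 0 = 0" "s 0 = 0" "s' 0 = 1"
  shows "c (2 * T) = 2 * (c T * s' T) - 1" "c' (2 * T) = 2 * (c T * c' T)"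
    "s (2 * T) = 2 * (s T * s' T)" "s' (2 * T) = 2 * (c T * s' T) - 1"
    and "c T * s' T - c' T * s T = 1"
proof -
  have W0: "c 0 * s' 0 - c' 0 * s 0 = 1" using init by simp
  have W: "c t * s' t - c' t * s t = 1" for t
    using wronskian_constant[OF c s, of t 0] init by simp
  have rc: "hill_solution q (\<lambda>t. c (0 - t)) (\<lambda>t. - c' (0 - t))"
    using hill_solution_reflect[OF c, of 0] even by simp
  have rs: "hill_solution q (\<lambda>t. s (0 - t)) (\<lambda>t. - s' (0 - t))"
    using hill_solution_reflect[OF s, of 0] even by simp
  have parity: "c (- t) = c t" "c' (- t) = - c' t" "s (- t) = - s t" "s' (- t) = s' t" for t
    using hill_solution_representation[OF c s rc W0, of t]
      hill_solution_representation[OF c s rs W0, of t] init by auto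
  have sc: "hill_solution q (\<lambda>t. c (t + 2 * T)) (\<lambda>t. c' (t + 2 * T))"
    using hill_solution_shift[OF c, of "2 * T"] per by simp
  have ss: "hill_solution q (\<lambda>t. s (t + 2 * T)) (\<lambda>t. s' (t + 2 * T))"
    using hill_solution_shift[OF s, of "2 * T"] per by simp
  \<comment> \<open>Evaluated at 0 with base point \<open>- T\<close>: the translated solutions take
    there their original values at \<open>T\<close>.\<close>
  note rep = hill_solution_representation[OF c s sc W, of 0 "- T"]
    hill_solution_representation[OF c s ss W, of 0 "- T"]
  show "c T * s' T - c' T * s T = 1" by (rule W)
  then show "c (2 * T) = 2 * (c T * s' T) - 1" "c' (2 * T) = 2 * (c T * c' T)"
    "s (2 * T) = 2 * (s T * s' T)" "s' (2 * T) = 2 * (c T * s' T) - 1"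
    using rep by (simp_all add: parity init algebra_simps)
qed

lemma hill_solution_iterate:
  assumes per: "\<And>t. q (t + P) = q t"
    and x: "hill_solution q x y"
  shows "hill_solution q (\<lambda>t. x (t + real n * P)) (\<lambda>t. y (t + real n * P))"
proof (induction n)
  case 0
  then show ?case using x by simp
next
  case (Suc n)
  have "(\<lambda>t. q (t + P)) = q" using per by blast
  then show ?case using hill_solution_shift[OF Suc, of P] by (simp add: algebra_simps)
qed

text \<open>The monodromy matrix has rows \<open>(m, 2 b)\<close> and \<open>(2 a, m)\<close> and
  determinant 1, so it preserves the form \<open>a X\<^sup>2 - b Y\<^sup>2\<close>. The hypothesis
  on \<open>c T * s' T\<close> means \<open>a * b < 0\<close>, so the form is definite and the
  values at multiples of the period stay bounded; compactness of one period covers the times in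
  between.\<close>

lemma hill_solution_bounded_forward:
  assumes even: "\<And>t. q (- t) = q t" and per: "\<And>t. q (t + 2 * T) = q t" and "T > 0"
    and c: "hill_solution q c c'" and s: "hill_solution q s s'"
    and init: "c 0 = 1" "c' 0 = 0" "s 0 = 0" "s' 0 = 1"
    and u: "0 < c T * s' T" "c T * s' T < 1"
    and x: "hill_solution q x y"
  shows "\<exists>C. \<forall>t\<ge>0. \<bar>x t\<bar> \<le> C \<and> \<bar>y t\<bar> \<le> C"
proof -
  note mono = hill_monodromy[OF even per c s init]
  have W0: "c 0 * s' 0 - c' 0 * s 0 = 1" using init by simp
  define X Y where XY: "X = (\<lambda>n. x (real n * (2 * T)))" "Y = (\<lambda>n. y (real n * (2 * T)))"
  define a b m where abm: "a = c T * c' T" "b = s T * s' T" "m = 2 * (c T * s' T) - 1"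
  have rep: "x (t + real n * (2 * T)) = X n * c t + Y n * s t"
    "y (t + real n * (2 * T)) = X n * c' t + Y n * s' t" for n t
    using hill_solution_representation[OF c s hill_solution_iterate[OF per x, of n] W0, of t] init
    by (auto simp: XY)
  have ab: "a * b = (c T * s' T) * (c T * s' T - 1)"
    using mono(5) unfolding abm by algebra
  then have "a * b < 0" using u by (simp add: mult_pos_neg)
  have m2: "m\<^sup>2 = 1 + 4 * a * b" using ab unfolding abm by algebra
  have step: "X (Suc n) = m * X n + 2 * b * Y n" "Y (Suc n) = 2 * a * X n + m * Y n" for n
    using rep[of "2 * T" n] unfolding mono abm by (auto simp: XY algebra_simps)
  have inv: "a * (X n)\<^sup>2 - b * (Y n)\<^sup>2 = a * (X 0)\<^sup>2 - b * (Y 0)\<^sup>2" for n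
  proof (induction n)
    case (Suc n)
    have "a * (X (Suc n))\<^sup>2 - b * (Y (Suc n))\<^sup>2 = (m\<^sup>2 - 4 * a * b) * (a * (X n)\<^sup>2 - b * (Y n)\<^sup>2)"
      unfolding step by algebra
    then show ?case using Suc m2 by simp
  qed simp
  \<comment> \<open>The extra factor \<open>a\<close> turns the invariant form into a positive one,
    whichever sign \<open>a\<close> has.\<close>
  define D where "D = a * (a * (X 0)\<^sup>2 - b * (Y 0)\<^sup>2)"
  have bd: "(a * X n)\<^sup>2 + (- (a * b)) * (Y n)\<^sup>2 = D" for n
    unfolding D_def inv[of n, symmetric] by algebra
  have a0: "a \<noteq> 0" using \<open>a * b < 0\<close> by auto
  have "(X n)\<^sup>2 \<le> D / a\<^sup>2" for n
    using bd[of n] \<open>a * b < 0\<close> a0 mult_nonneg_nonneg[of "- (a * b)" "(Y n)\<^sup>2"]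
    by (simp add: power_mult_distrib field_simps)
  then have X: "\<bar>X n\<bar> \<le> sqrt (D / a\<^sup>2)" for n using real_le_rsqrt real_sqrt_abs real_sqrt_le_iff by metis
  have "(Y n)\<^sup>2 \<le> D / (- (a * b))" for n
    using bd[of n] \<open>a * b < 0\<close> zero_le_power2[of "a * X n"]
    by (subst pos_le_divide_eq) (auto simp: mult.commute[of "(Y n)\<^sup>2"])
  then have Y: "\<bar>Y n\<bar> \<le> sqrt (D / (- (a * b)))" for n
    using real_le_rsqrt real_sqrt_abs real_sqrt_le_iff by metis
  define M where "M = max (sqrt (D / a\<^sup>2)) (sqrt (D / (- (a * b))))"
  have XYM: "\<bar>X n\<bar> \<le> M" "\<bar>Y n\<bar> \<le> M" for n
    using X[of n] Y[of n] unfolding M_def by auto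
  have "bounded (f ` {0..2 * T})" if "continuous_on {0..2 * T} f" for f :: "real \<Rightarrow> real"
    using that compact_continuous_image compact_imp_bounded by blast
  then have cb: "\<exists>B>0. \<forall>t\<in>{0..2 * T}. \<bar>f t\<bar> \<le> B" if "continuous_on {0..2 * T} f" for f :: "real \<Rightarrow> real"
    using that unfolding bounded_pos by auto
  obtain B1 B2 B3 B4 where B: "B1 > 0" "\<And>t. t \<in> {0..2 * T} \<Longrightarrow> \<bar>c t\<bar> \<le> B1"
      "B2 > 0" "\<And>t. t \<in> {0..2 * T} \<Longrightarrow> \<bar>c' t\<bar> \<le> B2"
      "B3 > 0" "\<And>t. t \<in> {0..2 * T} \<Longrightarrow> \<bar>s t\<bar> \<le> B3"
      "B4 > 0" "\<And>t. t \<in> {0..2 * T} \<Longrightarrow> \<bar>s' t\<bar> \<le> B4"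
    using cb[of c] cb[of c'] cb[of s] cb[of s'] hill_solution_continuous_on[OF c]
      hill_solution_continuous_on[OF s] by metis
  define B where "B = B1 + B2 + B3 + B4"
  have "\<bar>x t\<bar> \<le> M * B + M * B \<and> \<bar>y t\<bar> \<le> M * B + M * B" if "t \<ge> 0" for t
  proof -
    \<comment> \<open>The number of full periods up to \<open>t\<close>; \<open>r\<close> is the
      remaining time within one period.\<close>
    define n where "n = nat \<lfloor>t / (2 * T)\<rfloor>"
    define r where "r = t - real n * (2 * T)"
    have n: "real n = of_int \<lfloor>t / (2 * T)\<rfloor>" using that \<open>T > 0\<close> unfolding n_def by simp
    have "real n \<le> t / (2 * T)" "t / (2 * T) \<le> real n + 1" unfolding n by linarith+
    then have r: "r \<in> {0..2 * T}" using \<open>T > 0\<close> unfolding r_def by (auto simp: field_simps)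
    have t: "t = r + real n * (2 * T)" unfolding r_def by simp
    have "M \<ge> 0" using XYM(1)[of 0] by linarith
    have le: "\<bar>X n * v + Y n * w\<bar> \<le> M * B + M * B" if "\<bar>v\<bar> \<le> B" "\<bar>w\<bar> \<le> B" for v w
    proof -
      have "\<bar>X n * v + Y n * w\<bar> \<le> \<bar>X n\<bar> * \<bar>v\<bar> + \<bar>Y n\<bar> * \<bar>w\<bar>"
        by (metis abs_mult abs_triangle_ineq)
      also have "\<dots> \<le> M * B + M * B"
        using XYM[of n] that \<open>M \<ge> 0\<close> by (intro add_mono mult_mono) auto
      finally show ?thesis .
    qed
    show ?thesis unfolding t rep using B(1,3,5,7) B(2,4,6,8)[OF r]
      by (intro conjI le) (auto simp: B_def)
  qed
  then show ?thesis by blast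
qed

text \<open>Since \<open>q\<close> is even, time reversal maps solutions to solutions, and the
  forward bound also bounds the past.\<close>

lemma hill_stable:
  assumes even: "\<And>t. q (- t) = q t" and per: "\<And>t. q (t + 2 * T) = q t" and "T > 0"
    and c: "hill_solution q c c'" and s: "hill_solution q s s'"
    and init: "c 0 = 1" "c' 0 = 0" "s 0 = 0" "s' 0 = 1"
    and u: "0 < c T * s' T" "c T * s' T < 1"
    and x: "hill_solution q x y"
  shows "bounded (range (\<lambda>t. (x t, y t)))"
proof -
  note fwd = hill_solution_bounded_forward[OF even per \<open>T > 0\<close> c s init u]
  obtain C where C: "\<And>t. t \<ge> 0 \<Longrightarrow> \<bar>x t\<bar> \<le> C \<and> \<bar>y t\<bar> \<le> C" using fwd[OF x] by blast
  have "hill_solution q (\<lambda>t. x (0 - t)) (\<lambda>t. - y (0 - t))"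
    using hill_solution_reflect[OF x, of 0] even by simp
  from fwd[OF this] obtain C' where C': "\<And>t. t \<ge> 0 \<Longrightarrow> \<bar>x (- t)\<bar> \<le> C' \<and> \<bar>y (- t)\<bar> \<le> C'"
    by auto
  have "norm (x t, y t) \<le> 2 * max C C'" for t
  proof -
    have "norm (x t, y t) \<le> \<bar>x t\<bar> + \<bar>y t\<bar>" using norm_Pair_le[of "x t" "y t"] by simp
    moreover have "\<bar>x t\<bar> \<le> max C C'" "\<bar>y t\<bar> \<le> max C C'"
      using C[of t] C'[of "- t"] by (cases "t \<ge> 0"; force)+
    ultimately show ?thesis by linarith
  qed
  then show ?thesis unfolding bounded_iff by blast
qed

text \<open>Here \<open>a * b > 0\<close> and the trace \<open>2 m\<close> is below -2, so there is
  a real multiplier below -1; its Floquet solution grows geometrically along multiples of the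
  period.\<close>

lemma hill_unstable:
  assumes even: "\<And>t. q (- t) = q t" and per: "\<And>t. q (t + 2 * T) = q t"
    and c: "hill_solution q c c'" and s: "hill_solution q s s'"
    and init: "c 0 = 1" "c' 0 = 0" "s 0 = 0" "s' 0 = 1"
    and u: "c T * s' T < 0"
  shows "\<exists>x y. hill_solution q x y \<and> \<not> bounded (range (\<lambda>t. (x t, y t)))"
proof -
  note mono = hill_monodromy[OF even per c s init]
  define a b m where abm: "a = c T * c' T" "b = s T * s' T" "m = 2 * (c T * s' T) - 1"
  have ab: "a * b = (c T * s' T) * (c T * s' T - 1)"
    using mono(5) unfolding abm by algebra
  then have "a * b > 0" using u by (simp add: mult_neg_neg)
  then have b0: "b \<noteq> 0" and ab0: "a / b > 0" by (auto simp: zero_less_mult_iff zero_less_divide_iff)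
  \<comment> \<open>\<open>c + k s\<close> is the Floquet solution with multiplier \<open>m - 2 \<bar>b k\<bar> < -1\<close>.\<close>
  define k where "k = - sgn b * sqrt (a / b)"
  have k2: "b * k\<^sup>2 = a" using ab0 b0 unfolding k_def by (simp add: power_mult_distrib sgn_if)
  have bk: "b * k \<le> 0" using ab0 unfolding k_def by (simp add: sgn_if mult_nonpos_nonneg)
  define \<kappa> where "\<kappa> = m + 2 * b * k"
  have "\<kappa> < -1" unfolding \<kappa>_def abm(3) using bk u by simp
  define x y where xy: "x = (\<lambda>t. 1 * c t + k * s t)" "y = (\<lambda>t. 1 * c' t + k * s' t)"
  have x: "hill_solution q x y" unfolding xy by (rule hill_solution_linear_combination[OF c s])
  have W0: "c 0 * s' 0 - c' 0 * s 0 = 1" using init by simp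
  \<comment> \<open>The relation \<open>b k\<^sup>2 = a\<close> says that \<open>(1, k)\<close> is
    an eigenvector of the monodromy matrix for \<open>\<kappa>\<close>.\<close>
  have x2: "x (2 * T) = \<kappa>" and y2: "y (2 * T) = \<kappa> * k"
    unfolding xy mono \<kappa>_def abm(1)[symmetric] abm(2)[symmetric] abm(3)[symmetric]
     using k2 by (simp_all add: algebra_simps power2_eq_square)
  have per1: "x (t + 2 * T) = \<kappa> * x t" for t
  proof -
    have "hill_solution q (\<lambda>t. x (t + 2 * T)) (\<lambda>t. y (t + 2 * T))"
      using hill_solution_shift[OF x, of "2 * T"] per by simp
    from hill_solution_representation(1)[OF c s this W0, of t] show ?thesis
      using x2 y2 by (simp add: init) (simp add: xy algebra_simps)
  qed
  have xn: "x (real n * (2 * T)) = \<kappa> ^ n" for n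
  proof (induction n)
    case 0
    then show ?case by (simp add: xy init)
  next
    case (Suc n)
    then show ?case using per1[of "real n * (2 * T)"] by (simp add: algebra_simps)
  qed
  have "\<not> bounded (range (\<lambda>t. (x t, y t)))"
  proof
    assume "bounded (range (\<lambda>t. (x t, y t)))"
    then obtain B where B: "\<And>t. norm (x t, y t) \<le> B" unfolding bounded_iff by auto
    obtain n where "B < \<bar>\<kappa>\<bar> ^ n" using real_arch_pow[of "\<bar>\<kappa>\<bar>" B] \<open>\<kappa> < -1\<close> by auto
    moreover have "\<bar>x (real n * (2 * T))\<bar> \<le> B"
      using B[of "real n * (2 * T)"] norm_fst_le[of "x (real n * (2 * T))" "y (real n * (2 * T))"]
      by simp
    ultimately show False unfolding xn power_abs by linarith
  qed
  with x show ?thesis by blast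
qed

subsection \<open>The Mathieu equation near the resonance\<close>

definition mathieu_cosine :: "real \<Rightarrow> real \<Rightarrow> (real \<Rightarrow> real) \<Rightarrow> (real \<Rightarrow> real) \<Rightarrow> bool" where
  "mathieu_cosine \<beta> \<epsilon> x y \<longleftrightarrow>
     hill_solution (\<lambda>t. \<epsilon> * cos t + \<beta>) x y \<and> x 0 = 1 \<and> y 0 = 0"

lemma mathieu_solution_exists:
  "\<exists>x y. hill_solution (\<lambda>t. \<epsilon> * cos t + \<beta>) x y \<and> x 0 = x0 \<and> y 0 = y0"
proof (rule hill_solution_exists)
  fix t :: real
  have "(\<lambda>n. \<epsilon> * (cos_coeff n *\<^sub>R t ^ n) + \<beta> * ((if n = 0 then 1 else 0) * t ^ n))
      sums (\<epsilon> * cos t + \<beta> * t ^ 0)"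
    by (intro sums_add sums_mult cos_converges powser_sums_if)
  then show "(\<lambda>n. (\<epsilon> * cos_coeff n + \<beta> * (if n = 0 then 1 else 0)) * t ^ n) sums (\<epsilon> * cos t + \<beta>)"
    by (simp add: algebra_simps)
qed

lemma mathieu_cosine_resonant:
  "mathieu_cosine (9/4) 0 (\<lambda>t. cos (3/2 * t)) (\<lambda>t. - (3/2) * sin (3/2 * t))"
  unfolding mathieu_cosine_def hill_solution_def by (auto intro!: derivative_eq_intros)

lemma cos_3pi_half: "cos (3/2 * pi) = 0" and sin_3pi_half: "sin (3/2 * pi) = -1"
proof -
  have "3/2 * pi = pi + pi/2" by simp
  then show "cos (3/2 * pi) = 0" "sin (3/2 * pi) = -1"
    by (metis cos_periodic_pi2 cos_pi_half neg_equal_0_iff_equal)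
      (metis \<open>3/2 * pi = pi + pi/2\<close> sin_periodic_pi2 sin_pi_half)
qed

text \<open>A uniform neighbourhood, for value and derivative, of the unperturbed resonant solution.
  The tolerance 1/10 is small enough to keep the product integrals and the derivative at
  \<open>pi\<close> safely positive.\<close>

definition near_resonant :: "(real \<Rightarrow> real) \<Rightarrow> (real \<Rightarrow> real) \<Rightarrow> bool" where
  "near_resonant x y \<longleftrightarrow>
     (\<forall>t\<in>{0..pi}. \<bar>x t - cos (3/2 * t)\<bar> \<le> 1/10 \<and> \<bar>y t + 3/2 * sin (3/2 * t)\<bar> \<le> 1/10)"

text \<open>The reference solution has value 0 and derivative 3/2 at \<open>pi\<close>. The lower
  bound on \<open>y pi\<close> later lets the sign of \<open>x pi\<close> be read off a
  Wronskian.\<close>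

lemma near_resonant_bounds:
  assumes "near_resonant x y"
  shows "t \<in> {0..pi} \<Longrightarrow> \<bar>x t\<bar> \<le> 11/10" and "\<bar>x pi\<bar> \<le> 1/10" and "y pi \<ge> 1"
proof -
  show "\<bar>x t\<bar> \<le> 11/10" if "t \<in> {0..pi}"
  proof -
    have "\<bar>x t - cos (3/2 * t)\<bar> \<le> 1/10" using assms that unfolding near_resonant_def by blast
    then show ?thesis using abs_cos_le_one[of "3/2 * t"] by linarith
  qed
  have "pi \<in> {0..pi}" by simp
  then have "\<bar>x pi - cos (3/2 * pi)\<bar> \<le> 1/10 \<and> \<bar>y pi + 3/2 * sin (3/2 * pi)\<bar> \<le> 1/10"
    using assms unfolding near_resonant_def by blast
  then show "\<bar>x pi\<bar> \<le> 1/10" "y pi \<ge> 1" unfolding cos_3pi_half sin_3pi_half by linarith+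
qed

text \<open>Lipschitz dependence on both parameters with an explicit constant. The bound 5 covers
  all parameters within distance 1 of \<open>9/4\<close> and 0 in each coordinate; the bound 2
  covers both the resonant cosine and solutions near it.\<close>

lemma mathieu_cosine_perturbation:
  assumes 1: "mathieu_cosine \<beta>1 \<epsilon>1 x1 y1" and 2: "mathieu_cosine \<beta>2 \<epsilon>2 x2 y2"
    and small: "\<bar>\<beta>1\<bar> + \<bar>\<epsilon>1\<bar> \<le> 5"
    and bd: "\<And>t. t \<in> {0..pi} \<Longrightarrow> \<bar>x2 t\<bar> \<le> 2" and t: "t \<in> {0..pi}"
  shows "(x1 t - x2 t)\<^sup>2 + (y1 t - y2 t)\<^sup>2
    \<le> (2 * (\<bar>\<beta>1 - \<beta>2\<bar> + \<bar>\<epsilon>1 - \<epsilon>2\<bar>))\<^sup>2 * (pi * exp (7 * pi))"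
proof -
  have cosle: "\<bar>e * cos t\<bar> \<le> \<bar>e\<bar>" for e t :: real
    by (simp add: abs_mult mult_left_le)
  have "(x1 t - x2 t)\<^sup>2 + (y1 t - y2 t)\<^sup>2
    \<le> (2 * (\<bar>\<beta>1 - \<beta>2\<bar> + \<bar>\<epsilon>1 - \<epsilon>2\<bar>))\<^sup>2 * pi * exp ((2 + 5) * pi)"
  proof (rule hill_solution_perturbation[OF _ _ _ _ _ _ t])
    show "\<bar>\<epsilon>1 * cos t + \<beta>1\<bar> \<le> 5" if "t \<in> {0..pi}" for t
      using cosle[of \<epsilon>1 t] small by linarith
    show "\<bar>(\<epsilon>1 * cos t + \<beta>1 - (\<epsilon>2 * cos t + \<beta>2)) * x2 t\<bar>
        \<le> 2 * (\<bar>\<beta>1 - \<beta>2\<bar> + \<bar>\<epsilon>1 - \<epsilon>2\<bar>)" if "t \<in> {0..pi}" for t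
    proof -
      have "\<epsilon>1 * cos t + \<beta>1 - (\<epsilon>2 * cos t + \<beta>2) = (\<epsilon>1 - \<epsilon>2) * cos t + (\<beta>1 - \<beta>2)"
        by (simp add: algebra_simps)
      then have "\<bar>\<epsilon>1 * cos t + \<beta>1 - (\<epsilon>2 * cos t + \<beta>2)\<bar> \<le> \<bar>\<beta>1 - \<beta>2\<bar> + \<bar>\<epsilon>1 - \<epsilon>2\<bar>"
        using cosle[of "\<epsilon>1 - \<epsilon>2" t] by linarith
      then have "\<bar>\<epsilon>1 * cos t + \<beta>1 - (\<epsilon>2 * cos t + \<beta>2)\<bar> * \<bar>x2 t\<bar>
          \<le> (\<bar>\<beta>1 - \<beta>2\<bar> + \<bar>\<epsilon>1 - \<epsilon>2\<bar>) * 2"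
        using bd[OF that] by (intro mult_mono) auto
      then show ?thesis by (simp add: abs_mult)
    qed
  qed (use 1 2 in \<open>auto simp: mathieu_cosine_def\<close>)
  then show ?thesis by (simp add: mult.assoc)
qed

lemma near_resonant_neighbourhood:
  "\<exists>\<rho>>0. \<rho> \<le> 1 \<and> (\<forall>\<beta> \<epsilon> x y. \<bar>\<beta> - 9/4\<bar> \<le> \<rho> \<longrightarrow> \<bar>\<epsilon>\<bar> \<le> \<rho> \<longrightarrow>
     mathieu_cosine \<beta> \<epsilon> x y \<longrightarrow> near_resonant x y)"
proof -
  define G where "G = pi * exp (7 * pi)"
  have "pi \<ge> 1" using pi_gt3 by linarith
  have "1 * 1 \<le> G" unfolding G_def using \<open>pi \<ge> 1\<close> by (intro mult_mono) auto
  then have G: "G \<ge> 1" by simp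
  \<comment> \<open>Chosen so that \<open>(4 * \<rho>)\<^sup>2 * G\<close> is the squared tolerance;
    the 4 is the factor 2 of the perturbation bound times two parameter deviations of at most
    \<open>\<rho>\<close>.\<close>
  define \<rho> where "\<rho> = 1 / (40 * sqrt G)"
  have "sqrt G \<ge> 1" using G by simp
  then have "0 < 40 * sqrt G" "1 \<le> 40 * sqrt G" by linarith+
  then have \<rho>: "\<rho> > 0" "\<rho> \<le> 1"
    unfolding \<rho>_def by (simp_all only: zero_less_divide_1_iff divide_le_eq_1_pos)
  have \<rho>G: "(4 * \<rho>)\<^sup>2 * G = (1/10)\<^sup>2" using G unfolding \<rho>_def by (simp add: power_divide power_mult_distrib)
  have "near_resonant x y" if "\<bar>\<beta> - 9/4\<bar> \<le> \<rho>" "\<bar>\<epsilon>\<bar> \<le> \<rho>" and x: "mathieu_cosine \<beta> \<epsilon> x y" for \<beta> \<epsilon> x y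
    unfolding near_resonant_def
  proof
    fix t assume t: "t \<in> {0..pi}"
    define d e where "d = x t - cos (3/2 * t)" and "e = y t + 3/2 * sin (3/2 * t)"
    have "\<bar>\<beta>\<bar> + \<bar>\<epsilon>\<bar> \<le> 5" using that(1,2) \<rho> by linarith
    moreover have "\<bar>cos (3/2 * t)\<bar> \<le> 2" for t :: real
      by (rule order_trans[OF abs_cos_le_one]) simp
    ultimately have "d\<^sup>2 + e\<^sup>2 \<le> (2 * (\<bar>\<beta> - 9/4\<bar> + \<bar>\<epsilon>\<bar>))\<^sup>2 * G"
      using mathieu_cosine_perturbation[OF x mathieu_cosine_resonant _ _ t]
      unfolding G_def d_def e_def by simp
    also have "\<dots> \<le> (4 * \<rho>)\<^sup>2 * G"
      using that(1,2) G by (intro mult_right_mono power_mono) auto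
    finally have "d\<^sup>2 + e\<^sup>2 \<le> (1/10)\<^sup>2" unfolding \<rho>G .
    then have "d\<^sup>2 \<le> (1/10)\<^sup>2" "e\<^sup>2 \<le> (1/10)\<^sup>2"
      using zero_le_power2[of d] zero_le_power2[of e] by linarith+
    then show "\<bar>x t - cos (3/2 * t)\<bar> \<le> 1/10 \<and> \<bar>y t + 3/2 * sin (3/2 * t)\<bar> \<le> 1/10"
      unfolding d_def[symmetric] e_def[symmetric] abs_le_square_iff[symmetric] by simp
  qed
  with \<rho> show ?thesis by blast
qed

lemma resonant_square_integral:
  "((\<lambda>t. (cos (3/2 * t))\<^sup>2 - c) has_integral (1/2 - c) * pi) {0..pi}"
proof -
  have "((\<lambda>t. (cos (3/2 * t))\<^sup>2 - c) has_integral
      ((1/2 - c) * pi + sin (3/2 * pi) * cos (3/2 * pi) / 3)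
      - ((1/2 - c) * 0 + sin (3/2 * 0) * cos (3/2 * 0) / 3)) {0..pi}"
  proof (rule fundamental_theorem_of_calculus)
    fix t :: real
    have "((\<lambda>t. (1/2 - c) * t + sin (3/2 * t) * cos (3/2 * t) / 3) has_real_derivative
        (1/2 - c) + ((cos (3/2 * t))\<^sup>2 - (sin (3/2 * t))\<^sup>2) / 2) (at t within {0..pi})"
      by (auto intro!: derivative_eq_intros simp: power2_eq_square field_simps)
    also have "(1/2 - c) + ((cos (3/2 * t))\<^sup>2 - (sin (3/2 * t))\<^sup>2) / 2 = (cos (3/2 * t))\<^sup>2 - c"
      unfolding sin_squared_eq by (simp add: field_simps)
    finally show "((\<lambda>t. (1/2 - c) * t + sin (3/2 * t) * cos (3/2 * t) / 3) has_vector_derivative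
        (cos (3/2 * t))\<^sup>2 - c) (at t within {0..pi})"
      unfolding has_real_derivative_iff_has_vector_derivative .
  qed simp
  then show ?thesis unfolding cos_3pi_half by simp
qed

text \<open>The product differs from the squared cosine by at most 1/10 + 1/10 + 1/100 = 21/100,
  which leaves a mean of 1/2 - 21/100 = 29/100 over an interval longer than 3.\<close>

lemma near_resonant_product_integral:
  assumes x: "continuous_on {0..pi} x" and u: "continuous_on {0..pi} u"
    and near: "\<And>t. t \<in> {0..pi} \<Longrightarrow> \<bar>x t - cos (3/2 * t)\<bar> \<le> 1/10"
      "\<And>t. t \<in> {0..pi} \<Longrightarrow> \<bar>u t - cos (3/2 * t)\<bar> \<le> 1/10"
  shows "integral {0..pi} (\<lambda>t. x t * u t) \<ge> 1/2"
proof -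
  have "29/100 * pi \<le> integral {0..pi} (\<lambda>t. x t * u t)"
  proof (rule has_integral_le)
    show "((\<lambda>t. (cos (3/2 * t))\<^sup>2 - 21/100) has_integral 29/100 * pi) {0..pi}"
      using resonant_square_integral[of "21/100"] by simp
    show "((\<lambda>t. x t * u t) has_integral integral {0..pi} (\<lambda>t. x t * u t)) {0..pi}"
      by (intro integrable_integral integrable_continuous_real continuous_intros x u)
    fix t assume t: "t \<in> {0..pi}"
    define C d e where "C = cos (3/2 * t)" "d = x t - C" "e = u t - C"
    have "\<bar>C\<bar> \<le> 1" "\<bar>d\<bar> \<le> 1/10" "\<bar>e\<bar> \<le> 1/10" using near[OF t] unfolding C_d_e_def by auto
    then have "\<bar>C * e\<bar> \<le> 1 * (1/10)" "\<bar>C * d\<bar> \<le> 1 * (1/10)" "\<bar>d * e\<bar> \<le> 1/10 * (1/10)"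
      unfolding abs_mult by (intro mult_mono; simp)+
    moreover have "x t * u t = C\<^sup>2 + C * e + C * d + d * e"
      unfolding C_d_e_def by (simp add: power2_eq_square algebra_simps)
    ultimately show "(cos (3/2 * t))\<^sup>2 - 21/100 \<le> x t * u t"
      unfolding C_d_e_def(1)[symmetric] by linarith
  qed
  then show ?thesis using pi_gt3 by linarith
qed

lemma integral_abs_bound:
  fixes f :: "real \<Rightarrow> real"
  assumes "continuous_on {0..pi} f" and "\<And>t. t \<in> {0..pi} \<Longrightarrow> \<bar>f t\<bar> \<le> B"
  shows "\<bar>integral {0..pi} f\<bar> \<le> B * 4"
proof -
  have "\<bar>f 0\<bar> \<le> B" by (rule assms(2)) simp
  then have "B \<ge> 0" by linarith
  have "norm (integral {0..pi} f) \<le> B * (pi - 0)"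
    by (rule integral_bound) (use assms in auto)
  also have "\<dots> \<le> B * 4" using pi_less_4 \<open>B \<ge> 0\<close> by (intro mult_left_mono) auto
  finally show ?thesis by simp
qed

text \<open>Green's identity for two parameter pairs; the boundary term at 0 vanishes because the
  initial data agree. The positive lower bound on \<open>J\<close> gives monotonicity in
  \<open>\<beta>\<close>, and the bound on \<open>J'\<close> controls the dependence on
  \<open>\<epsilon>\<close>.\<close>

lemma resonant_wronskian:
  assumes 1: "mathieu_cosine \<beta>1 \<epsilon>1 x1 y1" "near_resonant x1 y1"
    and 2: "mathieu_cosine \<beta>2 \<epsilon>2 x2 y2" "near_resonant x2 y2"
  obtains J J' where "J \<ge> 1/2" "\<bar>J'\<bar> \<le> 8"
    "y1 pi * x2 pi - x1 pi * y2 pi = (\<beta>2 - \<beta>1) * J + (\<epsilon>2 - \<epsilon>1) * J'"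
proof -
  have h1: "hill_solution (\<lambda>t. \<epsilon>1 * cos t + \<beta>1) x1 y1" and h2: "hill_solution (\<lambda>t. \<epsilon>2 * cos t + \<beta>2) x2 y2"
    using 1 2 unfolding mathieu_cosine_def by auto
  note cont[continuous_intros] = hill_solution_continuous_on[OF h1] hill_solution_continuous_on[OF h2]
  define J where "J = integral {0..pi} (\<lambda>t. x1 t * x2 t)"
  define J' where "J' = integral {0..pi} (\<lambda>t. cos t * (x1 t * x2 t))"
  have "((\<lambda>t. - x1 t * (- (\<epsilon>2 * cos t + \<beta>2) * x2 t + (\<epsilon>1 * cos t + \<beta>1) * x2 t)) has_integral
      (y1 pi * x2 pi - x1 pi * y2 pi) - (y1 0 * x2 0 - x1 0 * y2 0)) {0..pi}"
    by (rule green_identity[OF h1]) (use hill_solution_derivs[OF h2] in auto)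
  also have "(\<lambda>t. - x1 t * (- (\<epsilon>2 * cos t + \<beta>2) * x2 t + (\<epsilon>1 * cos t + \<beta>1) * x2 t))
      = (\<lambda>t. (\<beta>2 - \<beta>1) * (x1 t * x2 t) + (\<epsilon>2 - \<epsilon>1) * (cos t * (x1 t * x2 t)))"
    by (simp add: algebra_simps)
  finally have "((\<lambda>t. (\<beta>2 - \<beta>1) * (x1 t * x2 t) + (\<epsilon>2 - \<epsilon>1) * (cos t * (x1 t * x2 t)))
      has_integral y1 pi * x2 pi - x1 pi * y2 pi) {0..pi}"
    using 1 2 unfolding mathieu_cosine_def by simp
  moreover have "((\<lambda>t. (\<beta>2 - \<beta>1) * (x1 t * x2 t) + (\<epsilon>2 - \<epsilon>1) * (cos t * (x1 t * x2 t)))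
      has_integral (\<beta>2 - \<beta>1) * J + (\<epsilon>2 - \<epsilon>1) * J') {0..pi}"
    unfolding J_def J'_def
    by (intro has_integral_add has_integral_mult_right integrable_integral
        integrable_continuous_real continuous_intros)
  ultimately have "y1 pi * x2 pi - x1 pi * y2 pi = (\<beta>2 - \<beta>1) * J + (\<epsilon>2 - \<epsilon>1) * J'"
    by (rule has_integral_unique)
  moreover have "J \<ge> 1/2" unfolding J_def
    using 1(2) 2(2) unfolding near_resonant_def
    by (intro near_resonant_product_integral continuous_intros) auto
  moreover have "\<bar>J'\<bar> \<le> 2 * 4" unfolding J'_def
  proof (intro integral_abs_bound continuous_intros)
    fix t assume t: "t \<in> {0..pi}"
    have "\<bar>cos t\<bar> * (\<bar>x1 t\<bar> * \<bar>x2 t\<bar>) \<le> 1 * (11/10 * (11/10))"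
      using near_resonant_bounds(1)[OF 1(2) t] near_resonant_bounds(1)[OF 2(2) t]
      by (intro mult_mono) auto
    then show "\<bar>cos t * (x1 t * x2 t)\<bar> \<le> 2" by (simp add: abs_mult)
  qed
  ultimately show thesis using that by simp
qed

text \<open>The curve \<open>b\<close> consists of zeros of \<open>\<beta> \<mapsto> x pi\<close>,
  which exist by the intermediate value theorem. Comparing with the solution at
  \<open>b \<epsilon>\<close> gives the sign; comparing two points of the curve gives the Lipschitz
  constant 16 = 8 / (1/2).\<close>

lemma resonance_curve:
  obtains \<rho> \<epsilon>0 b where "0 < \<epsilon>0" "\<epsilon>0 \<le> \<rho>"
    "\<And>\<beta> \<epsilon> x y. \<lbrakk>\<bar>\<beta> - 9/4\<bar> \<le> \<rho>; \<bar>\<epsilon>\<bar> \<le> \<rho>; mathieu_cosine \<beta> \<epsilon> x y\<rbrakk> \<Longrightarrow> near_resonant x y"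
    "\<And>\<epsilon>. \<bar>\<epsilon>\<bar> < \<epsilon>0 \<Longrightarrow> \<bar>b \<epsilon> - 9/4\<bar> \<le> \<rho>"
    "\<And>\<beta> \<epsilon> x y. \<lbrakk>\<bar>\<beta> - 9/4\<bar> \<le> \<rho>; \<bar>\<epsilon>\<bar> < \<epsilon>0; mathieu_cosine \<beta> \<epsilon> x y\<rbrakk> \<Longrightarrow> sgn (x pi) = sgn (\<beta> - b \<epsilon>)"
    "\<And>\<epsilon> \<epsilon>'. \<lbrakk>\<bar>\<epsilon>\<bar> < \<epsilon>0; \<bar>\<epsilon>'\<bar> < \<epsilon>0\<rbrakk> \<Longrightarrow> \<bar>b \<epsilon> - b \<epsilon>'\<bar> \<le> 16 * \<bar>\<epsilon> - \<epsilon>'\<bar>"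
proof -
  obtain \<rho> where \<rho>: "\<rho> > 0" "\<rho> \<le> 1"
    and near: "\<And>\<beta> \<epsilon> x y. \<lbrakk>\<bar>\<beta> - 9/4\<bar> \<le> \<rho>; \<bar>\<epsilon>\<bar> \<le> \<rho>; mathieu_cosine \<beta> \<epsilon> x y\<rbrakk> \<Longrightarrow> near_resonant x y"
    using near_resonant_neighbourhood by blast
  \<comment> \<open>Then \<open>\<bar>\<epsilon> * J'\<bar> \<le> \<rho> / 4\<close>, while at the
    ends of the \<open>\<beta>\<close>-interval the other term has size at least
    \<open>\<rho> / 2\<close> and decides the sign.\<close>
  define \<epsilon>0 where "\<epsilon>0 = \<rho> / 32"
  have \<epsilon>0: "0 < \<epsilon>0" "\<epsilon>0 \<le> \<rho>" unfolding \<epsilon>0_def using \<rho> by auto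
  have "\<exists>z. mathieu_cosine \<beta> \<epsilon> (fst z) (snd z)" for \<beta> \<epsilon>
    using mathieu_solution_exists[of \<epsilon> \<beta> 1 0] unfolding mathieu_cosine_def by auto
  \<comment> \<open>Choosing one solution for each parameter pair makes the value at
    \<open>pi\<close> a function of \<open>\<beta>\<close>.\<close>
  then obtain Z where Z: "\<And>\<beta> \<epsilon>. mathieu_cosine \<beta> \<epsilon> (fst (Z \<beta> \<epsilon>)) (snd (Z \<beta> \<epsilon>))" by metis
  define X Y where XY: "X \<beta> \<epsilon> = fst (Z \<beta> \<epsilon>)" "Y \<beta> \<epsilon> = snd (Z \<beta> \<epsilon>)" for \<beta> \<epsilon>
  have X: "mathieu_cosine \<beta> \<epsilon> (X \<beta> \<epsilon>) (Y \<beta> \<epsilon>)" for \<beta> \<epsilon> unfolding XY by (rule Z)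
  define I where "I = {9/4 - \<rho>..9/4 + \<rho>}"
  have I: "\<beta> \<in> I \<longleftrightarrow> \<bar>\<beta> - 9/4\<bar> \<le> \<rho>" for \<beta> unfolding I_def by auto
  have cont: "continuous_on I (\<lambda>\<beta>. X \<beta> \<epsilon> pi)" if \<epsilon>: "\<bar>\<epsilon>\<bar> \<le> \<rho>" for \<epsilon>
  proof -
    have "\<bar>X \<beta>1 \<epsilon> pi - X \<beta>2 \<epsilon> pi\<bar> \<le> 2 * sqrt (pi * exp (7 * pi)) * \<bar>\<beta>1 - \<beta>2\<bar>"
      if "\<beta>1 \<in> I" "\<beta>2 \<in> I" for \<beta>1 \<beta>2
    proof -
      have "\<bar>X \<beta>2 \<epsilon> t\<bar> \<le> 2" if "t \<in> {0..pi}" for t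
        using near_resonant_bounds(1)[OF near[OF _ \<epsilon> X] that, of \<beta>2] \<open>\<beta>2 \<in> I\<close> I by auto
      then have "(X \<beta>1 \<epsilon> pi - X \<beta>2 \<epsilon> pi)\<^sup>2 + (Y \<beta>1 \<epsilon> pi - Y \<beta>2 \<epsilon> pi)\<^sup>2
          \<le> (2 * \<bar>\<beta>1 - \<beta>2\<bar>)\<^sup>2 * (pi * exp (7 * pi))"
        using mathieu_cosine_perturbation[OF X X, of \<beta>1 \<epsilon> \<beta>2 \<epsilon> pi] that(1) I \<epsilon> \<rho> by auto
      then have "(X \<beta>1 \<epsilon> pi - X \<beta>2 \<epsilon> pi)\<^sup>2 \<le> (2 * \<bar>\<beta>1 - \<beta>2\<bar>)\<^sup>2 * (pi * exp (7 * pi))"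
        using zero_le_power2[of "Y \<beta>1 \<epsilon> pi - Y \<beta>2 \<epsilon> pi"] by linarith
      then have "sqrt ((X \<beta>1 \<epsilon> pi - X \<beta>2 \<epsilon> pi)\<^sup>2) \<le> sqrt ((2 * \<bar>\<beta>1 - \<beta>2\<bar>)\<^sup>2 * (pi * exp (7 * pi)))"
        by (rule real_sqrt_le_mono)
      then show ?thesis by (simp add: real_sqrt_mult mult_ac)
    qed
    then have "(2 * sqrt (pi * exp (7 * pi)))-lipschitz_on I (\<lambda>\<beta>. X \<beta> \<epsilon> pi)"
      by (intro lipschitz_onI) (auto simp: dist_real_def)
    then show ?thesis by (rule lipschitz_on_continuous_on)
  qed
  have "\<exists>\<beta>. \<beta> \<in> I \<and> X \<beta> \<epsilon> pi = 0" if \<epsilon>: "\<bar>\<epsilon>\<bar> < \<epsilon>0" for \<epsilon>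
  proof -
    have \<epsilon>': "\<bar>\<epsilon>\<bar> \<le> \<rho>" using \<epsilon> \<epsilon>0 by simp
    \<comment> \<open>The Wronskian with the resonant cosine at \<open>pi\<close> is just
      \<open>3/2\<close> times the value there, since that cosine vanishes at \<open>pi\<close> with
      derivative 3/2.\<close>
    have ends: "\<exists>J J'. J \<ge> 1/2 \<and> \<bar>\<epsilon> * J'\<bar> \<le> \<rho> / 4 \<and> 3/2 * X \<beta> \<epsilon> pi = (\<beta> - 9/4) * J + \<epsilon> * J'"
      if \<beta>: "\<bar>\<beta> - 9/4\<bar> \<le> \<rho>" for \<beta>
    proof -
      have "near_resonant (\<lambda>t. cos (3/2 * t)) (\<lambda>t. - (3/2) * sin (3/2 * t))"
        unfolding near_resonant_def by simp
      from resonant_wronskian[OF mathieu_cosine_resonant this X near[OF \<beta> \<epsilon>' X]]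
      obtain J J' where J: "J \<ge> 1/2" "\<bar>J'\<bar> \<le> 8"
        "- (3/2) * sin (3/2 * pi) * X \<beta> \<epsilon> pi - cos (3/2 * pi) * Y \<beta> \<epsilon> pi = (\<beta> - 9/4) * J + (\<epsilon> - 0) * J'"
        by metis
      have "\<bar>\<epsilon>\<bar> * \<bar>J'\<bar> \<le> \<rho> / 32 * 8"
        using \<epsilon> J unfolding \<epsilon>0_def by (intro mult_mono) auto
      then show ?thesis using J unfolding cos_3pi_half sin_3pi_half
        by (intro exI[of _ J] exI[of _ J']) (auto simp: abs_mult)
    qed
    from ends[of "9/4 - \<rho>"] \<rho> obtain J J' where "J \<ge> 1/2" "\<bar>\<epsilon> * J'\<bar> \<le> \<rho> / 4"
      "3/2 * X (9/4 - \<rho>) \<epsilon> pi = - (\<rho> * J) + \<epsilon> * J'" by auto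
    moreover from this \<rho> have "\<rho> * (1/2) \<le> \<rho> * J" by (intro mult_left_mono) auto
    ultimately have lo: "X (9/4 - \<rho>) \<epsilon> pi \<le> 0" using \<rho> by linarith
    from ends[of "9/4 + \<rho>"] \<rho> obtain J J' where "J \<ge> 1/2" "\<bar>\<epsilon> * J'\<bar> \<le> \<rho> / 4"
      "3/2 * X (9/4 + \<rho>) \<epsilon> pi = \<rho> * J + \<epsilon> * J'" by auto
    moreover from this \<rho> have "\<rho> * (1/2) \<le> \<rho> * J" by (intro mult_left_mono) auto
    ultimately have "0 \<le> X (9/4 + \<rho>) \<epsilon> pi" using \<rho> by linarith
    from IVT'[OF lo this _ cont[OF \<epsilon>', unfolded I_def]] \<rho> show ?thesis unfolding I_def by auto
  qed
  then obtain b where b: "\<And>\<epsilon>. \<bar>\<epsilon>\<bar> < \<epsilon>0 \<Longrightarrow> b \<epsilon> \<in> I \<and> X (b \<epsilon>) \<epsilon> pi = 0" by metis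
  have bnear: "near_resonant (X (b \<epsilon>) \<epsilon>) (Y (b \<epsilon>) \<epsilon>)" if "\<bar>\<epsilon>\<bar> < \<epsilon>0" for \<epsilon>
    using b[OF that] that \<epsilon>0 unfolding I by (intro near[OF _ _ X]) auto
  show thesis
  proof (rule that[OF \<epsilon>0 near])
    show "\<bar>b \<epsilon> - 9/4\<bar> \<le> \<rho>" if "\<bar>\<epsilon>\<bar> < \<epsilon>0" for \<epsilon> using b[OF that] I by blast
    show "sgn (x pi) = sgn (\<beta> - b \<epsilon>)"
      if \<beta>: "\<bar>\<beta> - 9/4\<bar> \<le> \<rho>" and \<epsilon>: "\<bar>\<epsilon>\<bar> < \<epsilon>0" and x: "mathieu_cosine \<beta> \<epsilon> x y" for \<beta> \<epsilon> x y
    proof -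
      have "near_resonant x y" using \<epsilon> \<epsilon>0 by (intro near[OF \<beta> _ x]) auto
      \<comment> \<open>With equal \<open>\<epsilon>\<close> and a zero at \<open>pi\<close> for the
        parameter \<open>b \<epsilon>\<close>, one term on each side drops out; the factors
        \<open>Y (b \<epsilon>) \<epsilon> pi\<close> and \<open>J\<close> are positive.\<close>
      from resonant_wronskian[OF X bnear[OF \<epsilon>] x this] obtain J where "J \<ge> 1/2"
        "Y (b \<epsilon>) \<epsilon> pi * x pi = (\<beta> - b \<epsilon>) * J" using b[OF \<epsilon>] by auto
      moreover have "Y (b \<epsilon>) \<epsilon> pi \<ge> 1" using near_resonant_bounds(3)[OF bnear[OF \<epsilon>]] .
      ultimately show ?thesis
        using sgn_mult[of "Y (b \<epsilon>) \<epsilon> pi" "x pi"] sgn_mult[of "\<beta> - b \<epsilon>" J] by simp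
    qed
    show "\<bar>b \<epsilon> - b \<epsilon>'\<bar> \<le> 16 * \<bar>\<epsilon> - \<epsilon>'\<bar>" if \<epsilon>: "\<bar>\<epsilon>\<bar> < \<epsilon>0" "\<bar>\<epsilon>'\<bar> < \<epsilon>0" for \<epsilon> \<epsilon>'
    proof -
      \<comment> \<open>Both solutions vanish at \<open>pi\<close>, hence so does their
        Wronskian.\<close>
      from resonant_wronskian[OF X bnear[OF \<epsilon>(1)] X bnear[OF \<epsilon>(2)]] obtain J J' where
        J: "J \<ge> 1/2" "\<bar>J'\<bar> \<le> 8" "0 = (b \<epsilon>' - b \<epsilon>) * J + (\<epsilon>' - \<epsilon>) * J'" using b[OF \<epsilon>(1)] b[OF \<epsilon>(2)] by auto
      have "\<bar>b \<epsilon> - b \<epsilon>'\<bar> * (1/2) \<le> \<bar>b \<epsilon> - b \<epsilon>'\<bar> * J" using J by (intro mult_left_mono) auto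
      also have "\<dots> = \<bar>(b \<epsilon> - b \<epsilon>') * J\<bar>" using J(1) by (simp add: abs_mult)
      also have "(b \<epsilon> - b \<epsilon>') * J = (\<epsilon>' - \<epsilon>) * J'" using J(3) by (simp add: algebra_simps)
      also have "\<bar>(\<epsilon>' - \<epsilon>) * J'\<bar> \<le> \<bar>\<epsilon> - \<epsilon>'\<bar> * 8"
        using J(2) by (simp add: abs_mult abs_minus_commute mult_left_mono)
      finally show ?thesis by simp
    qed
  qed
qed

subsection \<open>An approximate solution of sixth order\<close>

text \<open>The truncated subtraction at \<open>k = 0\<close> is correct: the frequencies \<open>-1/2\<close> and \<open>1/2\<close> give the
  same cosine.\<close>

lemma cosine_recurrence:
  "cos t * cos ((real k + 1/2) * t)
    = (cos ((real (Suc k) + 1/2) * t) + cos ((real (k - 1) + 1/2) * t)) / 2"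
proof (cases k)
  case 0
  have "cos (t - 1/2 * t) = cos (1/2 * t)" "cos (t + 1/2 * t) = cos (3/2 * t)" by (simp_all add: field_simps)
  then show ?thesis using 0 cos_times_cos[of t "1/2 * t"] by (simp add: field_simps)
next
  case (Suc j)
  have "t - (real k + 1/2) * t = - ((real (k - 1) + 1/2) * t)"
    "t + (real k + 1/2) * t = (real (Suc k) + 1/2) * t"
    using Suc by (simp_all add: algebra_simps)
  then show ?thesis using cos_times_cos[of t "(real k + 1/2) * t"] by (simp add: add.commute)
qed

text \<open>These sums have derivative 0 at 0 and value 0 at \<open>pi\<close>, the boundary
  conditions of the exact solution on the curve, and multiplication by \<open>cos t\<close>
  preserves their form.\<close>

definition half_odd_cosines :: "nat \<Rightarrow> (nat \<Rightarrow> real) \<Rightarrow> real \<Rightarrow> real" where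
  "half_odd_cosines n a t = (\<Sum>k<n. a k * cos ((real k + 1/2) * t))"

lemma cos_mult_half_odd_cosines:
  assumes "n > 0" and a: "\<And>k. n \<le> k \<Longrightarrow> a k = 0"
  shows "cos t * half_odd_cosines n a t
    = half_odd_cosines (Suc n) (\<lambda>k. (a (k - 1) + a (Suc k)) / 2) t"
proof -
  define e where "e k = cos ((real k + 1/2) * t)" for k
  obtain m where m: "n = Suc m" using \<open>n > 0\<close> gr0_conv_Suc by blast
  have "cos t * half_odd_cosines n a t = (\<Sum>k<n. a k * e (Suc k)) / 2 + (\<Sum>k<n. a k * e (k - 1)) / 2"
  proof -
    have "cos t * half_odd_cosines n a t = (\<Sum>k<n. a k * (cos t * cos ((real k + 1/2) * t)))"
      unfolding half_odd_cosines_def by (simp add: sum_distrib_left mult_ac)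
    also have "\<dots> = (\<Sum>k<n. (a k * e (Suc k)) / 2 + (a k * e (k - 1)) / 2)"
      unfolding cosine_recurrence e_def by (simp add: algebra_simps add_divide_distrib)
    finally show ?thesis by (simp add: sum.distrib sum_divide_distrib)
  qed
  \<comment> \<open>Truncated subtraction lets \<open>a 0 * e 0\<close> enter the shifted sum at
    index 0. It is removed here and reappears in the next sum, where it is the genuine reflected
    frequency.\<close>
  moreover have "(\<Sum>k<n. a k * e (Suc k)) = (\<Sum>k<Suc n. a (k - 1) * e k) - a 0 * e 0"
    by (simp only: sum.lessThan_Suc_shift) simp
  moreover have "(\<Sum>k<n. a k * e (k - 1)) = a 0 * e 0 + (\<Sum>k<Suc n. a (Suc k) * e k)"
    unfolding m sum.lessThan_Suc_shift[of _ m] using a[of "Suc m"] a[of "Suc (Suc m)"] by (simp add: m)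
  ultimately show ?thesis
    unfolding half_odd_cosines_def e_def[symmetric]
    by (simp only: add_divide_distrib distrib_right sum.distrib times_divide_eq_left
        sum_divide_distrib[symmetric]) (simp add: field_simps)
qed

text \<open>The numerical coefficients below come from solving \<open>trial_residual \<epsilon> k = 0\<close>, \<open>k = 0, 1, 2, \<dots>\<close>,
  order by order in \<open>\<epsilon>\<close>, normalised by \<open>trial_coeff \<epsilon> 1 = 1\<close>.\<close>

definition trial_parameter :: "real \<Rightarrow> real" where
  "trial_parameter \<epsilon> = 9/4 + 1/16 * \<epsilon>^2 - 1/32 * \<epsilon>^3 + 13/5120 * \<epsilon>^4 + 5/2048 * \<epsilon>^5"

text \<open>Each step away from the resonant index 1 costs one factor \<open>\<epsilon>\<close>, so
  entry \<open>k\<close> starts at order \<open>\<bar>k - 1\<bar>\<close>; entries from 7 on would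
  be of order six and are cut off.\<close>

definition trial_coeff :: "real \<Rightarrow> nat \<Rightarrow> real" where
  "trial_coeff \<epsilon> k = (if k < 7 then
    [- 1/4 * \<epsilon> + 1/16 * \<epsilon>^2 - 1/128 * \<epsilon>^3 - 1/256 * \<epsilon>^4 + 103/40960 * \<epsilon>^5,
     1,
     1/8 * \<epsilon> + 7/2560 * \<epsilon>^3 - 1/1024 * \<epsilon>^4 + 107/737280 * \<epsilon>^5,
     1/160 * \<epsilon>^2 + 17/92160 * \<epsilon>^4 - 7/102400 * \<epsilon>^5,
     1/5760 * \<epsilon>^3 + 1/172032 * \<epsilon>^5,
     1/322560 * \<epsilon>^4,
     1/25804800 * \<epsilon>^5] ! k else 0)"

text \<open>The coefficient of \<open>cos ((k + 1/2) t)\<close> in the defect of the trial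
  polynomial. At \<open>k = 0\<close> the truncated \<open>k - 1\<close> encodes that the
  frequencies -1/2 and 1/2 coincide.\<close>

definition trial_residual :: "real \<Rightarrow> nat \<Rightarrow> real" where
  "trial_residual \<epsilon> k = (trial_parameter \<epsilon> - (real k + 1/2)\<^sup>2) * trial_coeff \<epsilon> k
    + \<epsilon> * ((trial_coeff \<epsilon> (k - 1) + trial_coeff \<epsilon> (Suc k)) / 2)"

lemma powers_le_one:
  fixes \<epsilon> :: real
  assumes "\<bar>\<epsilon>\<bar> \<le> 1"
  shows "\<bar>\<epsilon> ^ n\<bar> \<le> 1"
  using assms by (simp add: power_abs power_le_one)

lemma trial_coeff_values:
  "trial_coeff \<epsilon> 0 = - 1/4 * \<epsilon> + 1/16 * \<epsilon>^2 - 1/128 * \<epsilon>^3 - 1/256 * \<epsilon>^4 + 103/40960 * \<epsilon>^5"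
  "trial_coeff \<epsilon> 1 = 1"
  "trial_coeff \<epsilon> 2 = 1/8 * \<epsilon> + 7/2560 * \<epsilon>^3 - 1/1024 * \<epsilon>^4 + 107/737280 * \<epsilon>^5"
  "trial_coeff \<epsilon> 3 = 1/160 * \<epsilon>^2 + 17/92160 * \<epsilon>^4 - 7/102400 * \<epsilon>^5"
  "trial_coeff \<epsilon> 4 = 1/5760 * \<epsilon>^3 + 1/172032 * \<epsilon>^5"
  "trial_coeff \<epsilon> 5 = 1/322560 * \<epsilon>^4"
  "trial_coeff \<epsilon> 6 = 1/25804800 * \<epsilon>^5"
  "trial_coeff \<epsilon> 7 = 0"
  "trial_coeff \<epsilon> 8 = 0"
  by (simp_all add: trial_coeff_def eval_nat_numeral)

lemmas trial_coeff_simps =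
  trial_coeff_values trial_coeff_values(2,3)[unfolded One_nat_def numeral_2_eq_2]

text \<open>Here and for the following indices all terms through fifth order cancel exactly, and the
  remaining cofactor is small for \<open>\<bar>\<epsilon>\<bar> \<le> 1\<close>.\<close>

lemma trial_residual_0:
  "trial_residual \<epsilon> 0 = \<epsilon>^6 *
    (33/40960 + 27/65536 * \<epsilon> - 141/1310720 * \<epsilon>^2 - 661/209715200 * \<epsilon>^3 + 103/16777216 * \<epsilon>^4)"
  unfolding trial_residual_def trial_parameter_def
  by (simp add: trial_coeff_simps power2_eq_square)
    (simp add: field_simps power_numeral_reduce)

text \<open>At the resonant frequency 3/2 the diagonal factor vanishes at order zero, so this
  equation fixes \<open>trial_parameter\<close> instead of a coefficient.\<close>

lemma trial_residual_1: "trial_residual \<epsilon> 1 = \<epsilon>^6 * (1961/1474560)"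
  unfolding trial_residual_def trial_parameter_def
  by (simp add: trial_coeff_simps power2_eq_square)
    (simp add: field_simps power_numeral_reduce)

lemma trial_residual_2:
  "trial_residual \<epsilon> 2 = \<epsilon>^6 *
    (51/409600 + 5489/117964800 * \<epsilon> - 1/2949120 * \<epsilon>^2 - 7609/3774873600 * \<epsilon>^3 + 107/301989888 * \<epsilon>^4)"
  unfolding trial_residual_def trial_parameter_def
  by (simp add: trial_coeff_simps power2_eq_square)
    (simp add: field_simps power_numeral_reduce)

lemma trial_residual_3:
  "trial_residual \<epsilon> 3 = \<epsilon>^6 *
    (5309/51609600 + 77/14745600 * \<epsilon> + 1229/471859200 * \<epsilon>^2 + 653/2359296000 * \<epsilon>^3 - 7/41943040 * \<epsilon>^4)"
  unfolding trial_residual_def trial_parameter_def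
  by (simp add: trial_coeff_simps power2_eq_square)
    (simp add: field_simps power_numeral_reduce)

lemma trial_residual_4:
  "trial_residual \<epsilon> 4 = \<epsilon>^6 *
    (- 73/1843200 + 83/103219200 * \<epsilon> + 1/4128768 * \<epsilon>^2 + 13/880803840 * \<epsilon>^3 + 5/352321536 * \<epsilon>^4)"
  unfolding trial_residual_def trial_parameter_def
  by (simp add: trial_coeff_simps power2_eq_square)
    (simp add: field_simps power_numeral_reduce)

lemma trial_residual_5:
  "trial_residual \<epsilon> 5 = \<epsilon>^6 *
    (23/7372800 - 1/10321920 * \<epsilon> + 13/1651507200 * \<epsilon>^2 + 1/132120576 * \<epsilon>^3)"
  unfolding trial_residual_def trial_parameter_def
  by (simp add: trial_coeff_simps power2_eq_square)
    (simp add: field_simps power_numeral_reduce)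

lemma trial_residual_6:
  "trial_residual \<epsilon> 6 = \<epsilon>^6 *
    (1/412876800 * \<epsilon> - 1/825753600 * \<epsilon>^2 + 13/132120576000 * \<epsilon>^3 + 1/10569646080 * \<epsilon>^4)"
  unfolding trial_residual_def trial_parameter_def
  by (simp add: trial_coeff_simps power2_eq_square)
    (simp add: field_simps power_numeral_reduce)

text \<open>The cut-off error: the last coefficient spills over into the frequency 15/2.\<close>

lemma trial_residual_7: "trial_residual \<epsilon> 7 = \<epsilon>^6 * (1/51609600)"
  unfolding trial_residual_def trial_parameter_def
  by (simp add: trial_coeff_simps power2_eq_square)
    (simp add: field_simps power_numeral_reduce)

lemma powers_le_abs:
  fixes \<epsilon> :: real
  assumes "\<bar>\<epsilon>\<bar> \<le> 1" "n > 0"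
  shows "\<bar>\<epsilon> ^ n\<bar> \<le> \<bar>\<epsilon>\<bar>"
  using power_decreasing[of 1 n "\<bar>\<epsilon>\<bar>"] assms by (simp add: power_abs)

text \<open>Apart from the normalised entry 1, everything in the trial polynomial is a small
  correction to \<open>cos (3/2 * t)\<close>.\<close>

lemma trial_coeff_bound:
  assumes \<epsilon>: "\<bar>\<epsilon>\<bar> \<le> 1" and "k \<noteq> 1"
  shows "\<bar>trial_coeff \<epsilon> k\<bar> \<le> \<bar>\<epsilon>\<bar>"
proof (cases "k < 7")
  case True
  note p = powers_le_abs[OF \<epsilon>, of 2] powers_le_abs[OF \<epsilon>, of 3] powers_le_abs[OF \<epsilon>, of 4]
    powers_le_abs[OF \<epsilon>, of 5]
  have "k = 0 \<or> k = 2 \<or> k = 3 \<or> k = 4 \<or> k = 5 \<or> k = 6" using True \<open>k \<noteq> 1\<close> by linarith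
  then show ?thesis
  proof (elim disjE)
    assume "k = 0"
    with \<epsilon> p show ?thesis by (simp only: trial_coeff_values) linarith
  next
    assume "k = 2"
    with \<epsilon> p show ?thesis by (simp only: trial_coeff_values) linarith
  next
    assume "k = 3"
    with \<epsilon> p show ?thesis by (simp only: trial_coeff_values) linarith
  next
    assume "k = 4"
    with \<epsilon> p show ?thesis by (simp only: trial_coeff_values) linarith
  next
    assume "k = 5"
    with \<epsilon> p show ?thesis by (simp only: trial_coeff_values) linarith
  next
    assume "k = 6"
    with \<epsilon> p show ?thesis by (simp only: trial_coeff_values) linarith
  qed
qed (simp add: trial_coeff_def)

lemma trial_residual_bound:
  assumes \<epsilon>: "\<bar>\<epsilon>\<bar> \<le> 1"
  shows "\<bar>trial_residual \<epsilon> k\<bar> \<le> \<epsilon>^6"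
proof -
  note p = powers_le_one[OF \<epsilon>, of 2] powers_le_one[OF \<epsilon>, of 3] powers_le_one[OF \<epsilon>, of 4]
  have "\<exists>r. trial_residual \<epsilon> k = \<epsilon>^6 * r \<and> \<bar>r\<bar> \<le> 1"
  proof (cases "k < 8")
    case True
    then have "k = 0 \<or> k = 1 \<or> k = 2 \<or> k = 3 \<or> k = 4 \<or> k = 5 \<or> k = 6 \<or> k = 7" by linarith
    then show ?thesis
    proof (elim disjE)
      assume "k = 0"
      with \<epsilon> p show ?thesis by (simp only: trial_residual_0) (intro exI conjI, rule refl, linarith)
    next
      assume "k = 1"
      with \<epsilon> p show ?thesis by (simp only: trial_residual_1) (intro exI conjI, rule refl, linarith)
    next
      assume "k = 2"
      with \<epsilon> p show ?thesis by (simp only: trial_residual_2) (intro exI conjI, rule refl, linarith)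
    next
      assume "k = 3"
      with \<epsilon> p show ?thesis by (simp only: trial_residual_3) (intro exI conjI, rule refl, linarith)
    next
      assume "k = 4"
      with \<epsilon> p show ?thesis by (simp only: trial_residual_4) (intro exI conjI, rule refl, linarith)
    next
      assume "k = 5"
      with \<epsilon> p show ?thesis by (simp only: trial_residual_5) (intro exI conjI, rule refl, linarith)
    next
      assume "k = 6"
      with \<epsilon> p show ?thesis by (simp only: trial_residual_6) (intro exI conjI, rule refl, linarith)
    next
      assume "k = 7"
      with \<epsilon> p show ?thesis by (simp only: trial_residual_7) (intro exI conjI, rule refl, linarith)
    qed
  next
    case False
    \<comment> \<open>For \<open>k \<ge> 8\<close> even the index \<open>k - 1\<close> lies beyond
      the last coefficient.\<close>
    then show ?thesis by (intro exI[of _ 0]) (simp add: trial_residual_def trial_coeff_def)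
  qed
  then obtain r where "trial_residual \<epsilon> k = \<epsilon>^6 * r" "\<bar>r\<bar> \<le> 1" by blast
  then show ?thesis by (simp add: abs_mult mult_left_le)
qed

lemma half_odd_cosines_bound:
  assumes "\<And>k. k < n \<Longrightarrow> \<bar>a k\<bar> \<le> B"
  shows "\<bar>half_odd_cosines n a t\<bar> \<le> real n * B"
proof -
  have "\<bar>half_odd_cosines n a t\<bar> \<le> (\<Sum>k<n. \<bar>a k * cos ((real k + 1/2) * t)\<bar>)"
    unfolding half_odd_cosines_def by (rule sum_abs)
  also have "\<dots> \<le> (\<Sum>k<n. B)"
  proof (rule sum_mono)
    fix k assume "k \<in> {..<n}"
    then have "\<bar>a k\<bar> * \<bar>cos ((real k + 1/2) * t)\<bar> \<le> B * 1"
      using assms[of k] by (intro mult_mono) auto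
    then show "\<bar>a k * cos ((real k + 1/2) * t)\<bar> \<le> B" by (simp add: abs_mult)
  qed
  finally show ?thesis by simp
qed

lemma half_odd_cosines_pi: "half_odd_cosines n a pi = 0"
proof -
  have "cos ((real k + 1/2) * pi) = 0" for k
    using cos_add[of "real k * pi" "pi/2"] by (simp add: distrib_right sin_npi)
  then show ?thesis unfolding half_odd_cosines_def by simp
qed

text \<open>The first summand is the second derivative of the cosine sum, so the left side is its
  defect; collecting it by frequency yields the shape of \<open>trial_residual\<close>.\<close>

lemma half_odd_cosines_residual:
  assumes "n > 0" and "\<And>k. n \<le> k \<Longrightarrow> a k = 0"
  shows "half_odd_cosines n (\<lambda>k. - ((real k + 1/2)\<^sup>2 * a k)) t + (\<epsilon> * cos t + \<beta>) * half_odd_cosines n a t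
    = half_odd_cosines (Suc n)
        (\<lambda>k. (\<beta> - (real k + 1/2)\<^sup>2) * a k + \<epsilon> * ((a (k - 1) + a (Suc k)) / 2)) t"
proof -
  have ext: "half_odd_cosines n f t = half_odd_cosines (Suc n) f t" if "f n = 0" for f
    using that unfolding half_odd_cosines_def by simp
  have "(\<epsilon> * cos t + \<beta>) * half_odd_cosines n a t
      = \<epsilon> * (cos t * half_odd_cosines n a t) + \<beta> * half_odd_cosines n a t"
    by (simp add: algebra_simps)
  also note cos_mult_half_odd_cosines[of n a, OF assms]
  finally have "half_odd_cosines n (\<lambda>k. - ((real k + 1/2)\<^sup>2 * a k)) t + (\<epsilon> * cos t + \<beta>) * half_odd_cosines n a t
    = half_odd_cosines (Suc n) (\<lambda>k. - ((real k + 1/2)\<^sup>2 * a k)) t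
      + (\<epsilon> * half_odd_cosines (Suc n) (\<lambda>k. (a (k - 1) + a (Suc k)) / 2) t
        + \<beta> * half_odd_cosines (Suc n) a t)"
    using assms(2)[of n] by (simp add: ext)
  then show ?thesis
    unfolding half_odd_cosines_def
    by (simp only: sum_distrib_left sum.distrib[symmetric]) (simp add: algebra_simps)
qed

text \<open>With equal boundary conditions for \<open>x\<close> and the trial polynomial
  \<open>u\<close>, Green's identity gives
  \<open>(\<beta> - trial_parameter \<epsilon>) * J = - K\<close>. Then \<open>J \<ge> 1/2\<close>
  and \<open>\<bar>K\<bar> \<le> 40 * \<epsilon>^6\<close> give the constant 80.\<close>

lemma resonance_expansion:
  assumes x: "mathieu_cosine \<beta> \<epsilon> x y" "near_resonant x y" and "x pi = 0" and \<epsilon>: "\<bar>\<epsilon>\<bar> \<le> 1/100"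
  shows "\<bar>\<beta> - trial_parameter \<epsilon>\<bar> \<le> 80 * \<epsilon>^6"
proof -
  have h: "hill_solution (\<lambda>t. \<epsilon> * cos t + \<beta>) x y" and "y 0 = 0" using x(1) unfolding mathieu_cosine_def by auto
  define a where "a = trial_coeff \<epsilon>"
  have a7: "a k = 0" if "7 \<le> k" for k using that unfolding a_def trial_coeff_def by simp
  define u where "u = half_odd_cosines 7 a"
  define v where "v t = (\<Sum>k<7. - (a k * (real k + 1/2) * sin ((real k + 1/2) * t)))" for t
  define w where "w = half_odd_cosines 7 (\<lambda>k. - ((real k + 1/2)\<^sup>2 * a k))"
  define r where "r = half_odd_cosines (Suc 7) (trial_residual \<epsilon>)"
  have du: "(u has_real_derivative v t) (at t)" for t
    unfolding u_def v_def half_odd_cosines_def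
    by (auto intro!: derivative_eq_intros sum.cong simp: mult_ac)
  have dv: "(v has_real_derivative w t) (at t)" for t
    unfolding w_def v_def half_odd_cosines_def
    by (auto intro!: derivative_eq_intros sum.cong simp: mult_ac power2_eq_square)
  have cont_r: "continuous_on S r" for S
    unfolding r_def half_odd_cosines_def by (intro continuous_intros)
  have cont_u: "continuous_on S u" for S
    unfolding u_def half_odd_cosines_def by (intro continuous_intros)
  note cont[continuous_intros] = cont_r cont_u hill_solution_continuous_on[OF h]
  \<comment> \<open>The residual \<open>r\<close> belongs to
    \<open>trial_parameter \<epsilon>\<close>; passing to the true \<open>\<beta>\<close> adds a
    multiple of \<open>u\<close>.\<close>
  have res: "w t + (\<epsilon> * cos t + \<beta>) * u t = r t + (\<beta> - trial_parameter \<epsilon>) * u t" for t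
    using half_odd_cosines_residual[of 7 a t \<epsilon> "trial_parameter \<epsilon>", OF _ a7]
    unfolding u_def w_def r_def trial_residual_def[abs_def] a_def by (simp add: algebra_simps)
  \<comment> \<open>Seven coefficients of size at most 1/100 stay below 1/10; this is where the
    smallness of \<open>\<epsilon>\<close> is used.\<close>
  have u_near: "\<bar>u t - cos (3/2 * t)\<bar> \<le> 1/10" for t
  proof -
    have "u t - cos (3/2 * t) = half_odd_cosines 7 (\<lambda>k. if k = 1 then 0 else a k) t"
      unfolding u_def half_odd_cosines_def by (simp add: eval_nat_numeral a_def trial_coeff_values(2)[unfolded One_nat_def])
    also have "\<bar>\<dots>\<bar> \<le> real 7 * \<bar>\<epsilon>\<bar>"
      using \<epsilon> unfolding a_def by (intro half_odd_cosines_bound) (auto intro!: trial_coeff_bound[unfolded One_nat_def])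
    finally show ?thesis using \<epsilon> by simp
  qed
  define J where "J = integral {0..pi} (\<lambda>t. x t * u t)"
  define K where "K = integral {0..pi} (\<lambda>t. x t * r t)"
  have J: "J \<ge> 1/2" unfolding J_def
    using x(2) u_near unfolding near_resonant_def
    by (intro near_resonant_product_integral continuous_intros) auto
  have K: "\<bar>K\<bar> \<le> (10 * \<epsilon>^6) * 4" unfolding K_def
  proof (intro integral_abs_bound continuous_intros)
    fix t assume t: "t \<in> {0..pi}"
    have "\<bar>r t\<bar> \<le> real (Suc 7) * \<epsilon>^6"
      unfolding r_def using \<epsilon> by (intro half_odd_cosines_bound trial_residual_bound) auto
    then have "\<bar>x t\<bar> * \<bar>r t\<bar> \<le> 11/10 * (8 * \<epsilon>^6)"
      using near_resonant_bounds(1)[OF x(2) t] by (intro mult_mono) auto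
    also have "\<dots> \<le> 10 * \<epsilon>^6" by simp
    finally show "\<bar>x t * r t\<bar> \<le> 10 * \<epsilon>^6" by (simp add: abs_mult)
  qed
  have "v 0 = 0" unfolding v_def by simp
  moreover have "u pi = 0" unfolding u_def by (rule half_odd_cosines_pi)
  ultimately have "((\<lambda>t. - x t * (w t + (\<epsilon> * cos t + \<beta>) * u t)) has_integral 0) {0..pi}"
    using green_identity[OF h du dv, of pi] \<open>x pi = 0\<close> \<open>y 0 = 0\<close> by simp
  moreover have "((\<lambda>t. - (x t * r t) - (\<beta> - trial_parameter \<epsilon>) * (x t * u t)) has_integral
      (- K - (\<beta> - trial_parameter \<epsilon>) * J)) {0..pi}"
    unfolding J_def K_def
    by (intro has_integral_diff has_integral_neg has_integral_mult_right integrable_integral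
        integrable_continuous_real continuous_intros)
  moreover have "(\<lambda>t. - x t * (w t + (\<epsilon> * cos t + \<beta>) * u t))
      = (\<lambda>t. - (x t * r t) - (\<beta> - trial_parameter \<epsilon>) * (x t * u t))"
    unfolding res by (simp add: algebra_simps)
  ultimately have "0 = - K - (\<beta> - trial_parameter \<epsilon>) * J" using has_integral_unique by metis
  then have "K = - ((\<beta> - trial_parameter \<epsilon>) * J)" by simp
  then have "\<bar>\<beta> - trial_parameter \<epsilon>\<bar> * J = \<bar>K\<bar>" using J by (simp add: abs_mult)
  moreover have "\<bar>\<beta> - trial_parameter \<epsilon>\<bar> * (1/2) \<le> \<bar>\<beta> - trial_parameter \<epsilon>\<bar> * J"
    using J by (intro mult_left_mono) auto
  ultimately have "\<bar>\<beta> - trial_parameter \<epsilon>\<bar> * (1/2) \<le> 10 * \<epsilon>^6 * 4"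
    using K by (simp only:)
  then show ?thesis by simp
qed

subsection \<open>The stability boundary\<close>

lemma hamiltonian_solution_linH_hill:
  "hamiltonian_solution (linH \<mu> \<alpha> \<epsilon>) \<xi> \<eta>
    \<longleftrightarrow> hill_solution (\<lambda>t. \<epsilon> * cos t + (\<alpha> + \<mu>/4)) \<xi> \<eta>"
  unfolding hamiltonian_solution_linH_iff hill_solution_def by (simp add: add.assoc)

text \<open>The product is the quantity \<open>c T * s' T\<close> of the Hill criterion for the half
  period \<open>T = pi\<close>, with \<open>s' pi\<close> traded for a cosine solution at
  \<open>- \<epsilon>\<close>.\<close>

lemma linH_stability:
  assumes c: "mathieu_cosine (\<alpha> + \<mu>/4) \<epsilon> c c'" and d: "mathieu_cosine (\<alpha> + \<mu>/4) (- \<epsilon>) d d'"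
  shows "c pi * d pi < 0 \<Longrightarrow> \<not> hamiltonian_stable (linH \<mu> \<alpha> \<epsilon>)"
    and "0 < c pi * d pi \<Longrightarrow> c pi * d pi < 1 \<Longrightarrow> hamiltonian_stable (linH \<mu> \<alpha> \<epsilon>)"
proof -
  define q where "q = (\<lambda>t. \<epsilon> * cos t + (\<alpha> + \<mu>/4))"
  have even: "q (- t) = q t" and per: "q (t + 2 * pi) = q t" for t
    unfolding q_def by simp_all
  have hc: "hill_solution q c c'" "c 0 = 1" "c' 0 = 0"
    using c unfolding mathieu_cosine_def q_def by auto
  obtain s s' where s: "hill_solution q s s'" "s 0 = 0" "s' 0 = 1"
    using mathieu_solution_exists[of \<epsilon> "\<alpha> + \<mu>/4" 0 1] unfolding q_def by auto
  \<comment> \<open>\<open>t \<mapsto> pi - t\<close> exchanges \<open>\<epsilon>\<close> with \<open>- \<epsilon>\<close> and the two boundary value problems.\<close>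
  have "hill_solution q (\<lambda>t. d (pi - t)) (\<lambda>t. - d' (pi - t))"
    using d hill_solution_reflect[of "\<lambda>t. - \<epsilon> * cos t + (\<alpha> + \<mu>/4)" d d' pi]
    unfolding mathieu_cosine_def q_def by simp
  \<comment> \<open>The Wronskian of \<open>s\<close> with the reflected \<open>d\<close> equals
    \<open>s' pi\<close> at \<open>pi\<close> and \<open>d pi\<close> at 0.\<close>
  from wronskian_constant[OF s(1) this, of pi 0] have s': "s' pi = d pi"
    using s d unfolding mathieu_cosine_def by simp
  show "\<not> hamiltonian_stable (linH \<mu> \<alpha> \<epsilon>)" if "c pi * d pi < 0"
    using hill_unstable[OF even per hc(1) s(1) hc(2,3) s(2,3)] that
    unfolding s' hamiltonian_stable_def hamiltonian_solution_linH_hill q_def by blast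
  show "hamiltonian_stable (linH \<mu> \<alpha> \<epsilon>)" if "0 < c pi * d pi" "c pi * d pi < 1"
    using hill_stable[OF even per pi_gt_zero hc(1) s(1) hc(2,3) s(2,3)] that
    unfolding s' hamiltonian_stable_def hamiltonian_solution_linH_hill q_def by blast
qed

theorem mainTheorem4:
  "\<exists>\<alpha>\<^sub>m \<alpha>\<^sub>p :: real \<Rightarrow> real \<Rightarrow> real. \<forall>\<mu> :: real.
     stability_boundary_from (\<lambda>\<alpha> \<epsilon>. hamiltonian_stable (linH \<mu> \<alpha> \<epsilon>)) ((9 - \<mu>) / 4)
       (\<alpha>\<^sub>m \<mu>) (\<alpha>\<^sub>p \<mu>) \<and>
     (\<lambda>\<epsilon>. \<alpha>\<^sub>m \<mu> \<epsilon> - ((9 - \<mu>) / 4 + 1/16 * \<epsilon>^2 - 1/32 * \<epsilon>^3 + 13/5120 * \<epsilon>^4 + 5/2048 * \<epsilon>^5))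
       \<in> O[at_right 0](\<lambda>\<epsilon>. \<epsilon>^6) \<and>
     (\<lambda>\<epsilon>. \<alpha>\<^sub>p \<mu> \<epsilon> - ((9 - \<mu>) / 4 + 1/16 * \<epsilon>^2 + 1/32 * \<epsilon>^3 + 13/5120 * \<epsilon>^4 - 5/2048 * \<epsilon>^5))
       \<in> O[at_right 0](\<lambda>\<epsilon>. \<epsilon>^6)"
proof -
  obtain \<rho> \<epsilon>0 b where \<epsilon>0: "0 < \<epsilon>0" "\<epsilon>0 \<le> \<rho>"
    and near: "\<And>\<beta> \<epsilon> x y. \<lbrakk>\<bar>\<beta> - 9/4\<bar> \<le> \<rho>; \<bar>\<epsilon>\<bar> \<le> \<rho>; mathieu_cosine \<beta> \<epsilon> x y\<rbrakk> \<Longrightarrow> near_resonant x y"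
    and b: "\<And>\<epsilon>. \<bar>\<epsilon>\<bar> < \<epsilon>0 \<Longrightarrow> \<bar>b \<epsilon> - 9/4\<bar> \<le> \<rho>"
    and sgn: "\<And>\<beta> \<epsilon> x y. \<lbrakk>\<bar>\<beta> - 9/4\<bar> \<le> \<rho>; \<bar>\<epsilon>\<bar> < \<epsilon>0; mathieu_cosine \<beta> \<epsilon> x y\<rbrakk> \<Longrightarrow> sgn (x pi) = sgn (\<beta> - b \<epsilon>)"
    and lip: "\<And>\<epsilon> \<epsilon>'. \<lbrakk>\<bar>\<epsilon>\<bar> < \<epsilon>0; \<bar>\<epsilon>'\<bar> < \<epsilon>0\<rbrakk> \<Longrightarrow> \<bar>b \<epsilon> - b \<epsilon>'\<bar> \<le> 16 * \<bar>\<epsilon> - \<epsilon>'\<bar>"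
    by (rule resonance_curve) (rule that)
  have ex: "\<exists>x y. mathieu_cosine \<beta> \<epsilon> x y" for \<beta> \<epsilon>
    using mathieu_solution_exists[of \<epsilon> \<beta> 1 0] unfolding mathieu_cosine_def by auto
  \<comment> \<open>The resonant cosine vanishes at \<open>pi\<close>, so the sign rule at
    \<open>\<epsilon> = 0\<close> forces the curve through \<open>9/4\<close>.\<close>
  have b0: "b 0 = 9/4"
    using sgn[OF _ _ mathieu_cosine_resonant] \<epsilon>0 by (simp add: cos_3pi_half[simplified] sgn_if split: if_splits)
  have cont: "continuous_on {0..<\<epsilon>0} b" "continuous_on {0..<\<epsilon>0} (\<lambda>\<epsilon>. b (- \<epsilon>))"
  proof -
    have "16-lipschitz_on {0..<\<epsilon>0} b" "16-lipschitz_on {0..<\<epsilon>0} (\<lambda>\<epsilon>. b (- \<epsilon>))"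
      using lip lip[of "- e" "- e'" for e e']
      by (auto intro!: lipschitz_onI simp: dist_real_def abs_minus_commute)
    then show "continuous_on {0..<\<epsilon>0} b" "continuous_on {0..<\<epsilon>0} (\<lambda>\<epsilon>. b (- \<epsilon>))"
      by (auto intro: lipschitz_on_continuous_on)
  qed
  have expansion: "\<bar>b \<epsilon> - trial_parameter \<epsilon>\<bar> \<le> 80 * \<epsilon>^6" if "\<bar>\<epsilon>\<bar> < \<epsilon>0" "\<bar>\<epsilon>\<bar> \<le> 1/100" for \<epsilon>
  proof -
    obtain x y where x: "mathieu_cosine (b \<epsilon>) \<epsilon> x y" using ex by blast
    have "x pi = 0" using sgn[OF b[OF that(1)] that(1) x] by (simp add: sgn_0_0)
    moreover have "near_resonant x y" using that(1) \<epsilon>0 by (intro near[OF b[OF that(1)] _ x]) simp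
    ultimately show ?thesis using resonance_expansion[OF x _ _ that(2)] by blast
  qed
  have small: "\<forall>\<^sub>F \<epsilon> in at_right 0. 0 < \<epsilon> \<and> \<epsilon> < \<epsilon>0 \<and> \<epsilon> < (1/100::real)"
    using \<epsilon>0(1) by (intro eventually_conj eventually_at_right_less)
      (auto simp: eventually_at_right_field intro: exI[of _ \<epsilon>0] exI[of _ "1/100"])
  have boundary: "stability_boundary_from (\<lambda>\<alpha> \<epsilon>. hamiltonian_stable (linH \<mu> \<alpha> \<epsilon>)) ((9 - \<mu>) / 4)
      (\<lambda>\<epsilon>. b \<epsilon> - \<mu>/4) (\<lambda>\<epsilon>. b (- \<epsilon>) - \<mu>/4)" for \<mu>
    unfolding stability_boundary_from_def
  proof (intro exI conjI allI impI)
    show "0 < \<epsilon>0" "0 < \<rho>" using \<epsilon>0 by auto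
    show "continuous_on {0..<\<epsilon>0} (\<lambda>\<epsilon>. b \<epsilon> - \<mu>/4)" "continuous_on {0..<\<epsilon>0} (\<lambda>\<epsilon>. b (- \<epsilon>) - \<mu>/4)"
      by (intro continuous_intros cont)+
    show "b 0 - \<mu>/4 = (9 - \<mu>) / 4" "b (- 0) - \<mu>/4 = (9 - \<mu>) / 4" using b0 by (simp_all add: field_simps)
  next
    fix \<epsilon> \<alpha> assume A: "0 < \<epsilon> \<and> \<epsilon> < \<epsilon>0 \<and> \<bar>\<alpha> - (9 - \<mu>) / 4\<bar> < \<rho>"
    define \<beta> where "\<beta> = \<alpha> + \<mu>/4"
    have "\<beta> - 9/4 = \<alpha> - (9 - \<mu>) / 4" unfolding \<beta>_def by (simp add: field_simps)
    then have \<beta>: "\<bar>\<beta> - 9/4\<bar> \<le> \<rho>" using A by simp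
    obtain c c' d d' where c: "mathieu_cosine \<beta> \<epsilon> c c'" and d: "mathieu_cosine \<beta> (- \<epsilon>) d d'"
      using ex by meson
    have sc: "sgn (c pi) = sgn (\<beta> - b \<epsilon>)" and sd: "sgn (d pi) = sgn (\<beta> - b (- \<epsilon>))"
      using A sgn[OF \<beta> _ c] sgn[OF \<beta> _ d] by auto
    \<comment> \<open>The right side is negative strictly between the two curves and positive
      outside them, whichever curve is the lower one.\<close>
    have sgn_prod: "sgn (c pi * d pi) = sgn ((\<beta> - b \<epsilon>) * (\<beta> - b (- \<epsilon>)))"
      unfolding sgn_mult sc sd ..
    have "near_resonant c c'" "near_resonant d d'"
      using A \<epsilon>0 near[OF \<beta> _ c] near[OF \<beta> _ d] by auto
    \<comment> \<open>Both factors are near 0, so the upper condition of the stability criterion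
      holds and only the sign of the product matters.\<close>
    then have "\<bar>c pi\<bar> * \<bar>d pi\<bar> \<le> 1/10 * (1/10)"
      by (intro mult_mono near_resonant_bounds) auto
    then have "c pi * d pi < 1" using abs_ge_self[of "c pi * d pi"] unfolding abs_mult by linarith
    note stab = linH_stability[OF c[unfolded \<beta>_def] d[unfolded \<beta>_def]]
    show "\<not> hamiltonian_stable (linH \<mu> \<alpha> \<epsilon>)" if "\<alpha> \<in> open_segment (b \<epsilon> - \<mu>/4) (b (- \<epsilon>) - \<mu>/4)"
    proof (rule stab(1))
      have "(\<beta> - b \<epsilon>) * (\<beta> - b (- \<epsilon>)) < 0"
        using that unfolding open_segment_eq_real_ivl \<beta>_def mult_less_0_iff
        by (auto split: if_splits)
      then show "c pi * d pi < 0" using sgn_prod by (metis sgn_less)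
    qed
    show "hamiltonian_stable (linH \<mu> \<alpha> \<epsilon>)" if "\<alpha> \<notin> closed_segment (b \<epsilon> - \<mu>/4) (b (- \<epsilon>) - \<mu>/4)"
    proof (rule stab(2))
      have "0 < (\<beta> - b \<epsilon>) * (\<beta> - b (- \<epsilon>))"
        using that unfolding closed_segment_eq_real_ivl \<beta>_def zero_less_mult_iff
        by (auto split: if_splits)
      then show "0 < c pi * d pi" using sgn_prod by (metis sgn_greater)
    qed fact
  qed
  have asymp: "(\<lambda>\<epsilon>. b \<epsilon> - \<mu>/4 - ((9 - \<mu>) / 4 + 1/16 * \<epsilon>^2 - 1/32 * \<epsilon>^3 + 13/5120 * \<epsilon>^4 + 5/2048 * \<epsilon>^5))
       \<in> O[at_right 0](\<lambda>\<epsilon>. \<epsilon>^6)"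
    "(\<lambda>\<epsilon>. b (- \<epsilon>) - \<mu>/4 - ((9 - \<mu>) / 4 + 1/16 * \<epsilon>^2 + 1/32 * \<epsilon>^3 + 13/5120 * \<epsilon>^4 - 5/2048 * \<epsilon>^5))
       \<in> O[at_right 0](\<lambda>\<epsilon>. \<epsilon>^6)" for \<mu>
  proof -
    have m: "b \<epsilon> - \<mu>/4 - ((9 - \<mu>) / 4 + 1/16 * \<epsilon>^2 - 1/32 * \<epsilon>^3 + 13/5120 * \<epsilon>^4 + 5/2048 * \<epsilon>^5)
      = b \<epsilon> - trial_parameter \<epsilon>" for \<epsilon>
      unfolding trial_parameter_def by (simp add: diff_divide_distrib)
    \<comment> \<open>Replacing \<open>\<epsilon>\<close> by \<open>- \<epsilon>\<close> flips
      exactly the odd coefficients, which turns the expansion of one curve into that of the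
      other.\<close>
    have p: "b (- \<epsilon>) - \<mu>/4 - ((9 - \<mu>) / 4 + 1/16 * \<epsilon>^2 + 1/32 * \<epsilon>^3 + 13/5120 * \<epsilon>^4 - 5/2048 * \<epsilon>^5)
      = b (- \<epsilon>) - trial_parameter (- \<epsilon>)" for \<epsilon>
      unfolding trial_parameter_def by (simp add: diff_divide_distrib power_minus_odd)
    show "(\<lambda>\<epsilon>. b \<epsilon> - \<mu>/4 - ((9 - \<mu>) / 4 + 1/16 * \<epsilon>^2 - 1/32 * \<epsilon>^3 + 13/5120 * \<epsilon>^4 + 5/2048 * \<epsilon>^5))
       \<in> O[at_right 0](\<lambda>\<epsilon>. \<epsilon>^6)"
      unfolding m by (rule bigoI[of _ 80], rule eventually_mono[OF small]) (use expansion in auto)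
    show "(\<lambda>\<epsilon>. b (- \<epsilon>) - \<mu>/4 - ((9 - \<mu>) / 4 + 1/16 * \<epsilon>^2 + 1/32 * \<epsilon>^3 + 13/5120 * \<epsilon>^4 - 5/2048 * \<epsilon>^5))
       \<in> O[at_right 0](\<lambda>\<epsilon>. \<epsilon>^6)"
      unfolding p by (rule bigoI[of _ 80], rule eventually_mono[OF small])
        (use expansion[of "- \<epsilon>" for \<epsilon>] in auto)
  qed
  show ?thesis
    using boundary asymp
    by (intro exI[of _ "\<lambda>\<mu> \<epsilon>. b \<epsilon> - \<mu>/4"] exI[of _ "\<lambda>\<mu> \<epsilon>. b (- \<epsilon>) - \<mu>/4"]) simp
qed

end
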